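(* Let $\{x^k\}$ be a sequence generated by the augmented Lagrangian algorithm described in the context, applied to the problem (SOCP). Then any accumulation point of $\{x^k\}$ satisfies the AKKT2 conditions.
   Context: Problem (SOCP): minimize $f(x)$ over $x\in\mathbb{R}^n$ subject to $g_i(x)\in\mathcal{K}_i$ ($i=1,\dots,r$) and $h(x)=0$, where $f:\mathbb{R}^n\to\mathbb{R}$, $h:\mathbb{R}^n\to\mathbb{R}^p$, $g_i:\mathbb{R}^n\to\mathbb{R}^{m_i}$ are twice continuously differentiable. A vector $w\in\mathbb{R}^\ell$ is written $w=(w_0,\overline{w})\in\mathbb{R}\times\mathbb{R}^{\ell-1}$, and $[w]_0:=w_0$. $\mathcal{K}_i:=\{(w_0,\overline w)\in\mathbb{R}\times\mathbb{R}^{m_i-1}\mid w_0\ge\|\overline w\|\}$ if $m_i>1$ and $\mathcal{K}_i:=\{w\in\mathbb{R}\mid w\ge0\}$ if $m_i=1$; $\mathcal{K}:=\mathcal{K}_1\times\dots\times\mathcal{K}_r$, $g:=(g_1,\dots,g_r)$. $\|\cdot\|$ is the Euclidean norm, $\|\cdot\|_\infty$ the max norm, $\Pi_C$ is the Euclidean projection onto $C$, $D$ denotes the Jacobian (rows are transposed gradients), $I_\ell$ is the $\ell\times\ell$ identity matrix, and $X\succeq0$ means that the symmetric matrix $X$ is positive semidefinite. $\mathrm{int}(\mathcal{K}_i)$ is the set where $w_0>\|\overline w\|$, $\mathrm{bd}(\mathcal{K}_i)$ is the boundary of $\mathcal{K}_i$, and $\mathrm{bd}^+(\mathcal{K}_i)$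 the set where $w_0=\|\overline w\|\ne0$. Index sets: $I_0(x):=\{i\mid g_i(x)=0\}$, $I_B(x):=\{i\mid g_i(x)\in\mathrm{bd}^+(\mathcal{K}_i)\}$, $I_I(x):=\{i\mid g_i(x)\in\mathrm{int}(\mathcal{K}_i)\}$. Lagrangian: $L(x,\mu,\omega):=f(x)+\langle h(x),\mu\rangle-\langle g(x),\omega\rangle$ for $\mu\in\mathbb{R}^p$, $\omega=(\omega_1,\dots,\omega_r)\in\mathcal{K}$; $\nabla_x L,\nabla_x^2L$ are its gradient and Hessian in $x$. $\Gamma_i:=\begin{pmatrix}1 & 0^\top \\ 0 & -I_{m_i-1}\end{pmatrix}$, $\tilde g_i(x):=(\|\overline{g_i(x)}\|,\overline{g_i(x)})$, and, relative to $x^*$, $\sigma(x,\omega):=\sum_{i\in I_B(x^* )}-\frac{[\omega_i]_0}{[g_i(x)]_0}Dg_i(x)^\top\Gamma_iDg_i(x)$. AKKT conditions: $x^*$ satisfies the AKKT conditions if $x^*$ is feasible for (SOCP) and there exist sequences $\{x^k\}\subset\mathbb{R}^n$, $\{\mu^k\}\subset\mathbb{R}^p$, $\{\omega^k\}\subset\mathcal{K}$ such that $x^k\to x^*$; $\nabla_xL(x^k,\mu^k,\omega^k)\to0$; for $i\in I_I(x^* )$, $\omega_i^k\to0$; and for $i\in I_B(x^* )$, $\omega_i^k\to0$ or $\omega_i^k\in\mathrm{bd}^+(\mathcal{K}_i)$ with $\overline{\omega_i^k}/\|\overline{\omega_i^k}\|\to-\overline{g_i(x^* )}/\|\overline{g_i(x^*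 )}\|$. AKKT2 conditions: a feasible point $x^*$ satisfies the AKKT2 conditions (so feasibility of $x^*$ is part of the conditions) if there exist sequences $x^k\to x^*$, $\{\mu^k\}\subset\mathbb{R}^p$, $\{\omega^k\}\subset\mathcal{K}$ satisfying the AKKT conditions and, in addition, there exist $\{\eta^k\}\subset\mathbb{R}^p$, $\{\theta_i^k\}\subset\mathbb{R}$ ($i\in I_0(x^* )$), $\{\gamma_i^k\}\subset\mathbb{R}$ ($i\in I_B(x^* )$), $\{\delta_k\}\subset\mathbb{R}_+$ with $\delta_k\to0$, such that for all sufficiently large $k$ and all $d\in\mathbb{R}^n$, $$d^\top\Big(\nabla_x^2L(x^k,\mu^k,\omega^k)+\sigma(x^k,\omega^k)+\sum_{i=1}^p\eta_i^k\nabla h_i(x^k)\nabla h_i(x^k)^\top+\sum_{i\in I_B(x^* )}\gamma_i^k(Dg_i(x^k)^\top\Gamma_i\tilde g_i(x^k))(Dg_i(x^k)^\top\Gamma_i\tilde g_i(x^k))^\top+\sum_{i\in I_0(x^* )}\theta_i^kDg_i(x^k)^\top Dg_i(x^k)+\delta_kI_n\Big)d\ge0.$$ Augmented Lagrangian ($\rho>0$): $L_\rho(x,\mu,\omega):=f(x)+\frac1{2\rho}\{\|\mu-\rho h(x)\|^2+\sum_{i=1}^r(\|\Pi_{\mathcal{K}_i}(\omega_i-\rho g_i(x))\|^2-\|\omega_i\|^2)\}$, whose gradient in $x$ is $\nabla_xL_\rho(x,\mu,\omega)=\nabla f(x)-Dh(x)^\top(\mu-\rho h(x))-\sum_{i=1}^rDg_i(x)^\top\Pi_{\mathcal{K}_i}(\omega_i-\rho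 g_i(x))$. As a substitute for its Hessian in $x$, define $$\bar\nabla_x^2L_\rho(x,\mu,\omega):=\nabla_x^2L\big(x,-(\mu-\rho h(x)),\Pi_{\mathcal{K}}(\omega-\rho g(x))\big)+\rho\sum_{i=1}^p\nabla h_i(x)\nabla h_i(x)^\top+\rho\sum_{i=1}^rDg_i(x)^\top V_iDg_i(x),$$ where $V_i=I_{m_i}$ if $-g_i(x)\in\mathrm{bd}(\mathcal{K}_i)\cup\mathrm{int}(\mathcal{K}_i)$, $V_i=0$ if $-g_i(x)\in\mathrm{int}(-\mathcal{K}_i)$, and $V_i=M_i\left(-\frac{[g_i(x)]_0}{\|\overline{g_i(x)}\|},-\frac{\overline{g_i(x)}}{\|\overline{g_i(x)}\|}\right)$ otherwise, with $M_i(\xi,w):=\frac12\begin{pmatrix}1 & w^\top \\ w & (1+\xi)I_{m_i-1}-\xi ww^\top\end{pmatrix}$. Algorithm. Step 1: let $\gamma>1$, $\rho_1>0$, $\tau\in(0,1)$; define a sequence $\{\epsilon_k\}\subset\mathbb{R}_+$ with $\epsilon_k\to0$; set an initial point $x^0\in\mathbb{R}^n$, $\hat\mu^1\in\mathbb{R}^p$, $\hat\omega^1\in\mathcal{K}$; initialize $k:=1$ and $\|v^0\|:=+\infty$. Step 2: find an appropriate minimizer $x^k$ of $L_{\rho_k}(x,\hat\mu^k,\hat\omega^k)$ which satisfies $\|\nabla_xL_{\rho_k}(x^k,\hat\mu^k,\hat\omega^k)\|\le\epsilon_k$ and $\bar\nabla_x^2L_{\rho_k}(x^k,\hat\mu^k,\hat\omega^k)+\epsilon_kI_n\succeq0$.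 Step 3: let $v^k=(v_1^k,\dots,v_r^k)$ with $v_i^k:=\Pi_{\mathcal{K}_i}\left(\frac{\hat\omega_i^k}{\rho_k}-g_i(x^k)\right)-\frac{\hat\omega_i^k}{\rho_k}$ for all $i$; if $\max\{\|h(x^k)\|_\infty,\|v^k\|_\infty\}\le\tau\max\{\|h(x^{k-1})\|_\infty,\|v^{k-1}\|_\infty\}$ set $\rho_{k+1}=\rho_k$, otherwise set $\rho_{k+1}=\gamma\rho_k$. Step 4: compute $\mu^k:=\hat\mu^k-\rho_kh(x^k)$ and $\omega_i^k:=\Pi_{\mathcal{K}_i}(\hat\omega_i^k-\rho_kg_i(x^k))$ for all $i$. Step 5: define $\hat\mu^{k+1}\in\mathbb{R}^p$ and $\hat\omega^{k+1}\in\mathcal{K}$ such that they are uniformly bounded. Step 6: set $k:=k+1$ and go to Step 2.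
   Formalization: The problem (SOCP) is additionally assumed to have at least one feasible point (otherwise the claim fails, e.g. f=0, h(x)=x²+1), and "minimizer" in Step 2 is read as a global minimizer of the augmented Lagrangian over R^n. *)

theory Defs
  imports "HOL-Analysis.Analysis"
begin

section \<open>Derivatives\<close>

definition grad :: "(real^'n \<Rightarrow> real) \<Rightarrow> real^'n \<Rightarrow> real^'n" where
  "grad f x = (\<chi> j. frechet_derivative f (at x) (axis j 1))"

definition hess :: "(real^'n \<Rightarrow> real) \<Rightarrow> real^'n \<Rightarrow> real^'n^'n" where
  "hess f x = jacobian (grad f) (at x)"

definition twice_cont_diff :: "(real^'n \<Rightarrow> real) \<Rightarrow> bool" where
  "twice_cont_diff f \<longleftrightarrow>
     (\<forall>x. f differentiable (at x)) \<and> (\<forall>x. grad f differentiable (at x)) \<and>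
     continuous_on UNIV (hess f)"

definition outer :: "real^'n \<Rightarrow> real^'n^'n" where
  "outer v = (\<chi> i j. v $ i * v $ j)"

definition psd :: "real^'n^'n \<Rightarrow> bool" where
  "psd A \<longleftrightarrow> transpose A = A \<and> (\<forall>d. 0 \<le> d \<bullet> (A *v d))"


section \<open>Second-order cones\<close>

text \<open>
  The blocks \<open>\<real>\<^bsup>m i\<^esup>\<close> have sizes depending on \<open>i\<close>, so they are realised as coordinate subspaces
  of one ambient space \<open>real^('q option)\<close>: index \<open>None\<close> is coordinate \<open>0\<close>, and block \<open>i\<close> uses the
  tail coordinates \<open>Some j\<close> with \<open>j \<in> J i\<close>, i.e. \<open>m i = 1 + card (J i)\<close>, with \<open>J i = {}\<close> when
  \<open>m i = 1\<close>. Every family of sizes arises in this way for a large enough finite type \<open>'q\<close>.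
  Inner products, norms and projections onto subsets of the subspace are those of \<open>\<real>\<^bsup>m i\<^esup>\<close>.
\<close>

definition hd0 :: "real^('q::finite option) \<Rightarrow> real" where
  "hd0 w = w $ None"

definition tail :: "real^('q::finite option) \<Rightarrow> real^'q" where
  "tail w = (\<chi> j. w $ Some j)"

definition block :: "real \<Rightarrow> real^'q \<Rightarrow> real^('q::finite option)" where
  "block a w = (\<chi> i. case i of None \<Rightarrow> a | Some j \<Rightarrow> w $ j)"

definition block_space :: "'q set \<Rightarrow> (real^('q::finite option)) set" where
  "block_space T = {w. \<forall>j. j \<notin> T \<longrightarrow> tail w $ j = 0}"

text \<open>For \<open>T = {}\<close> the tail vanishes, so the following sets specialise to the half-line case.\<close>

definition soc :: "'q set \<Rightarrow> (real^('q::finite option)) set" where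
  "soc T = {w \<in> block_space T. norm (tail w) \<le> hd0 w}"

definition int_soc :: "'q set \<Rightarrow> (real^('q::finite option)) set" where
  "int_soc T = {w \<in> block_space T. norm (tail w) < hd0 w}"

text \<open>The boundary is taken in \<open>\<real>\<^bsup>m i\<^esup>\<close>, not in the ambient space.\<close>

definition bd_soc :: "'q set \<Rightarrow> (real^('q::finite option)) set" where
  "bd_soc T = (top_of_set (block_space T)) frontier_of (soc T)"

definition bdp_soc :: "'q set \<Rightarrow> (real^('q::finite option)) set" where
  "bdp_soc T = {w \<in> block_space T. hd0 w = norm (tail w) \<and> norm (tail w) \<noteq> 0}"

text \<open>
  The matrices below have the full ambient size. They only occur between \<open>Dg\<^sub>i(x)\<^sup>T\<close> and \<open>Dg\<^sub>i(x)\<close>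
  (or applied to vectors of the block), where the rows outside the block vanish.
\<close>

definition Gam :: "real^('q::finite option)^('q option)" where
  "Gam = (\<chi> i j. if i \<noteq> j then 0 else if i = None then 1 else - 1)"

definition Mmat :: "real \<Rightarrow> real^'q \<Rightarrow> real^('q::finite option)^('q option)" where
  "Mmat \<xi> w = (\<chi> i j. 1/2 *
     (case (i, j) of
        (None, None) \<Rightarrow> 1
      | (None, Some b) \<Rightarrow> w $ b
      | (Some a, None) \<Rightarrow> w $ a
      | (Some a, Some b) \<Rightarrow> (1 + \<xi>) * (if a = b then 1 else 0) - \<xi> * (w $ a * w $ b)))"


section \<open>The problem\<close>

locale socp =
  fixes f :: "real^'n \<Rightarrow> real"
    and g :: "real^'n \<Rightarrow> real^('q::finite option)^'r"
    and h :: "real^'n \<Rightarrow> real^'p"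
    and J :: "'r \<Rightarrow> 'q set"
  assumes f_C2: "twice_cont_diff f"
    and g_C2: "\<And>i a. twice_cont_diff (\<lambda>x. g x $ i $ a)"
    and h_C2: "\<And>i. twice_cont_diff (\<lambda>x. h x $ i)"
    and g_block: "\<And>x i. g x $ i \<in> block_space (J i)"
begin

definition cones :: "(real^('q option)^'r) set" where
  "cones = {w. \<forall>i. w $ i \<in> soc (J i)}"

definition feasible :: "real^'n \<Rightarrow> bool" where
  "feasible x \<longleftrightarrow> g x \<in> cones \<and> h x = 0"

definition I0 :: "real^'n \<Rightarrow> 'r set" where
  "I0 x = {i. g x $ i = 0}"

definition IB :: "real^'n \<Rightarrow> 'r set" where
  "IB x = {i. g x $ i \<in> bdp_soc (J i)}"

definition II :: "real^'n \<Rightarrow> 'r set" where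
  "II x = {i. g x $ i \<in> int_soc (J i)}"

definition Dg :: "'r \<Rightarrow> real^'n \<Rightarrow> real^'n^('q option)" where
  "Dg i x = jacobian (\<lambda>y. g y $ i) (at x)"

definition gtilde :: "'r \<Rightarrow> real^'n \<Rightarrow> real^('q option)" where
  "gtilde i x = block (norm (tail (g x $ i))) (tail (g x $ i))"

definition lagr :: "real^'n \<Rightarrow> real^'p \<Rightarrow> real^('q option)^'r \<Rightarrow> real" where
  "lagr x \<mu> \<omega> = f x + h x \<bullet> \<mu> - g x \<bullet> \<omega>"

definition grad_lagr :: "real^'n \<Rightarrow> real^'p \<Rightarrow> real^('q option)^'r \<Rightarrow> real^'n" where
  "grad_lagr x \<mu> \<omega> = grad (\<lambda>y. lagr y \<mu> \<omega>) x"

definition hess_lagr :: "real^'n \<Rightarrow> real^'p \<Rightarrow> real^('q option)^'r \<Rightarrow> real^'n^'n" where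
  "hess_lagr x \<mu> \<omega> = hess (\<lambda>y. lagr y \<mu> \<omega>) x"

definition sigma_term :: "real^'n \<Rightarrow> real^'n \<Rightarrow> real^('q option)^'r \<Rightarrow> real^'n^'n" where
  "sigma_term xs x \<omega> = (\<Sum>i\<in>IB xs.
     (- (hd0 (\<omega> $ i) / hd0 (g x $ i))) *\<^sub>R (transpose (Dg i x) ** Gam ** Dg i x))"


section \<open>Sequential optimality conditions\<close>

definition AKKT_seqs ::
  "real^'n \<Rightarrow> (nat \<Rightarrow> real^'n) \<Rightarrow> (nat \<Rightarrow> real^'p) \<Rightarrow> (nat \<Rightarrow> real^('q option)^'r) \<Rightarrow> bool" where
  "AKKT_seqs xs x \<mu> \<omega> \<longleftrightarrow>
     (\<forall>k. \<omega> k \<in> cones) \<and>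
     x \<longlonglongrightarrow> xs \<and>
     (\<lambda>k. grad_lagr (x k) (\<mu> k) (\<omega> k)) \<longlonglongrightarrow> 0 \<and>
     (\<forall>i\<in>II xs. (\<lambda>k. \<omega> k $ i) \<longlonglongrightarrow> 0) \<and>
     (\<forall>i\<in>IB xs.
        (\<lambda>k. \<omega> k $ i) \<longlonglongrightarrow> 0 \<or>
        (\<forall>k. \<omega> k $ i \<in> bdp_soc (J i)) \<and>
        (\<lambda>k. tail (\<omega> k $ i) /\<^sub>R norm (tail (\<omega> k $ i)))
          \<longlonglongrightarrow> - (tail (g xs $ i) /\<^sub>R norm (tail (g xs $ i))))"

definition AKKT2_matrix ::
  "real^'n \<Rightarrow> real^'n \<Rightarrow> real^'p \<Rightarrow> real^('q option)^'r \<Rightarrow>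
   real^'p \<Rightarrow> ('r \<Rightarrow> real) \<Rightarrow> ('r \<Rightarrow> real) \<Rightarrow> real \<Rightarrow> real^'n^'n" where
  "AKKT2_matrix xs x \<mu> \<omega> \<eta> \<theta> \<gamma> \<delta> =
     hess_lagr x \<mu> \<omega> + sigma_term xs x \<omega>
     + (\<Sum>i\<in>UNIV. (\<eta> $ i) *\<^sub>R outer (grad (\<lambda>y. h y $ i) x))
     + (\<Sum>i\<in>IB xs. \<gamma> i *\<^sub>R outer (transpose (Dg i x) *v (Gam *v gtilde i x)))
     + (\<Sum>i\<in>I0 xs. \<theta> i *\<^sub>R (transpose (Dg i x) ** Dg i x))
     + \<delta> *\<^sub>R mat 1"

definition AKKT2 :: "real^'n \<Rightarrow> bool" where
  "AKKT2 xs \<longleftrightarrow> feasible xs \<and>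
     (\<exists>x \<mu> \<omega>. AKKT_seqs xs x \<mu> \<omega> \<and>
       (\<exists>(\<eta> :: nat \<Rightarrow> real^'p) (\<theta> :: nat \<Rightarrow> 'r \<Rightarrow> real) (\<gamma> :: nat \<Rightarrow> 'r \<Rightarrow> real)
         (\<delta> :: nat \<Rightarrow> real).
          (\<forall>k. 0 \<le> \<delta> k) \<and> \<delta> \<longlonglongrightarrow> 0 \<and>
          (\<forall>\<^sub>F k in sequentially. \<forall>d.
             0 \<le> d \<bullet> (AKKT2_matrix xs (x k) (\<mu> k) (\<omega> k) (\<eta> k) (\<theta> k) (\<gamma> k) (\<delta> k) *v d))))"


section \<open>The augmented Lagrangian algorithm\<close>

definition aug_lagr :: "real \<Rightarrow> real^'n \<Rightarrow> real^'p \<Rightarrow> real^('q option)^'r \<Rightarrow> real" where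
  "aug_lagr \<rho> x \<mu> \<omega> = f x + 1 / (2 * \<rho>) *
     ((norm (\<mu> - \<rho> *\<^sub>R h x))\<^sup>2 +
      (\<Sum>i\<in>UNIV. (norm (closest_point (soc (J i)) (\<omega> $ i - \<rho> *\<^sub>R g x $ i)))\<^sup>2
                 - (norm (\<omega> $ i))\<^sup>2))"

text \<open>The selection depends on \<open>-g\<^sub>i(x)\<close> only, not on the multiplier or on \<open>\<rho>\<close>.
  The set \<open>int (-K\<^sub>i)\<close> is \<open>- int K\<^sub>i\<close>.\<close>

definition Vmat :: "'r \<Rightarrow> real^'n \<Rightarrow> real^('q option)^('q option)" where
  "Vmat i x =
     (if - g x $ i \<in> bd_soc (J i) \<union> int_soc (J i) then mat 1
      else if - g x $ i \<in> uminus ` int_soc (J i) then 0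
      else Mmat (- (hd0 (g x $ i) / norm (tail (g x $ i))))
                (- (tail (g x $ i) /\<^sub>R norm (tail (g x $ i)))))"

definition bar_hess_aug_lagr ::
  "real \<Rightarrow> real^'n \<Rightarrow> real^'p \<Rightarrow> real^('q option)^'r \<Rightarrow> real^'n^'n" where
  "bar_hess_aug_lagr \<rho> x \<mu> \<omega> =
     hess_lagr x (- (\<mu> - \<rho> *\<^sub>R h x)) (closest_point cones (\<omega> - \<rho> *\<^sub>R g x))
     + \<rho> *\<^sub>R (\<Sum>i\<in>UNIV. outer (grad (\<lambda>y. h y $ i) x))
     + \<rho> *\<^sub>R (\<Sum>i\<in>UNIV. transpose (Dg i x) ** Vmat i x ** Dg i x)"

text \<open>\<open>max {\<parallel>h(x\<^sup>k)\<parallel>\<^sub>\<infinity>, \<parallel>v\<^sup>k\<parallel>\<^sub>\<infinity>}\<close>, with the convention \<open>\<parallel>v\<^sup>0\<parallel> = \<infinity>\<close>.\<close>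

definition resid :: "(nat \<Rightarrow> real^'n) \<Rightarrow> (nat \<Rightarrow> real^('q option)^'r) \<Rightarrow> nat \<Rightarrow> ereal" where
  "resid x v k = max (ereal (infnorm (h (x k)))) (if k = 0 then \<infinity> else ereal (infnorm (v k)))"

text \<open>
  A run of the algorithm; \<open>\<mu>h\<close>, \<open>\<omega>h\<close> are the safeguarded multiplier estimates (with hats).
  Apart from the initial point \<open>x 0\<close>, only the entries with index \<open>k \<ge> 1\<close> are used.
  A minimizer of the augmented Lagrangian is a (global) minimizer over \<open>real^'n\<close>.
\<close>

definition ALM_run ::
  "real \<Rightarrow> real \<Rightarrow> (nat \<Rightarrow> real) \<Rightarrow> (nat \<Rightarrow> real) \<Rightarrow> (nat \<Rightarrow> real^'n) \<Rightarrow>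
   (nat \<Rightarrow> real^'p) \<Rightarrow> (nat \<Rightarrow> real^('q option)^'r) \<Rightarrow> (nat \<Rightarrow> real^('q option)^'r) \<Rightarrow>
   (nat \<Rightarrow> real^'p) \<Rightarrow> (nat \<Rightarrow> real^('q option)^'r) \<Rightarrow> bool" where
  "ALM_run \<gamma> \<tau> \<epsilon> \<rho> x \<mu>h \<omega>h v \<mu> \<omega> \<longleftrightarrow>
     \<gamma> > 1 \<and> \<rho> 1 > 0 \<and> 0 < \<tau> \<and> \<tau> < 1 \<and>
     (\<forall>k\<ge>1. 0 \<le> \<epsilon> k) \<and> \<epsilon> \<longlonglongrightarrow> 0 \<and>
     (\<forall>k\<ge>1. \<forall>y. aug_lagr (\<rho> k) (x k) (\<mu>h k) (\<omega>h k) \<le> aug_lagr (\<rho> k) y (\<mu>h k) (\<omega>h k)) \<and>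
     (\<forall>k\<ge>1. norm (grad (\<lambda>y. aug_lagr (\<rho> k) y (\<mu>h k) (\<omega>h k)) (x k)) \<le> \<epsilon> k) \<and>
     (\<forall>k\<ge>1. psd (bar_hess_aug_lagr (\<rho> k) (x k) (\<mu>h k) (\<omega>h k) + \<epsilon> k *\<^sub>R mat 1)) \<and>
     (\<forall>k\<ge>1. \<forall>i. v k $ i =
        closest_point (soc (J i)) (\<omega>h k $ i /\<^sub>R \<rho> k - g (x k) $ i) - \<omega>h k $ i /\<^sub>R \<rho> k) \<and>
     (\<forall>k\<ge>1. \<rho> (Suc k) =
        (if resid x v k \<le> ereal \<tau> * resid x v (k - 1) then \<rho> k else \<gamma> * \<rho> k)) \<and>
     (\<forall>k\<ge>1. \<mu> k = \<mu>h k - \<rho> k *\<^sub>R h (x k)) \<and>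
     (\<forall>k\<ge>1. \<forall>i. \<omega> k $ i = closest_point (soc (J i)) (\<omega>h k $ i - \<rho> k *\<^sub>R g (x k) $ i)) \<and>
     (\<forall>k\<ge>1. \<omega>h k \<in> cones) \<and>
     bounded (\<mu>h ` {1..}) \<and> bounded (\<omega>h ` {1..})"

definition ALM_generated :: "(nat \<Rightarrow> real^'n) \<Rightarrow> bool" where
  "ALM_generated x \<longleftrightarrow> (\<exists>\<gamma> \<tau> \<epsilon> \<rho> \<mu>h \<omega>h v \<mu> \<omega>. ALM_run \<gamma> \<tau> \<epsilon> \<rho> x \<mu>h \<omega>h v \<mu> \<omega>)"

end

definition accumulation_point :: "(nat \<Rightarrow> 'a::topological_space) \<Rightarrow> 'a \<Rightarrow> bool" where
  "accumulation_point x a \<longleftrightarrow> (\<exists>s. strict_mono s \<and> (x \<circ> s) \<longlonglongrightarrow> a)"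

end

theory Submission
  imports Defs
begin

text \<open>
  Every run carries its own complementarity. The vector \<open>s\<^sub>i = v\<^sub>i + g\<^sub>i(x)\<close> is \<open>1/\<rho>\<close> times the residual
  of the projection that defines \<open>\<omega>\<^sub>i\<close>; since the second-order cone is self-dual, the Moreau
  decomposition puts \<open>s\<^sub>i\<close> in the cone and makes it orthogonal to \<open>\<omega>\<^sub>i\<close> (\<open>ALM_run_slack\<close>).

  Along a subsequence that converges to \<open>xs\<close>, both \<open>h(x)\<close> and \<open>v\<close> tend to zero
  (\<open>ALM_run_residuals_tendsto_0\<close>): for bounded penalties because the residual test is eventually
  always passed, for unbounded ones because \<open>x\<close> is a global minimizer and a feasible point exists.
  So \<open>xs\<close> is feasible and \<open>s\<^sub>i\<close> tends to \<open>g\<^sub>i(xs)\<close>. If that limit is interior, orthogonality forces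
  \<open>\<omega>\<^sub>i = 0\<close>; if it is a nonzero boundary point, \<open>\<omega>\<^sub>i\<close> either vanishes or is a boundary point whose tail
  is opposite to that of \<open>s\<^sub>i\<close> (\<open>soc_complementarity\<close>). There are finitely many blocks, so a further
  subsequence makes the same alternative hold at every index. The gradient of the augmented
  Lagrangian is the gradient of the Lagrangian at \<open>(-\<mu>, \<omega>)\<close> (\<open>grad_aug_lagr\<close>); the sign comes from
  the opposite conventions of the Lagrangian and of the multiplier update. This gives the first-order
  conditions.

  For the second-order condition the Hessian of the Lagrangian is common to both matrices and only
  the terms \<open>\<rho> Dg\<^sub>i\<^sup>T V\<^sub>i Dg\<^sub>i\<close> have to be compared (\<open>AKKT2_matrix_psd_exists\<close>). They vanish for interior
  blocks and are absorbed by \<open>\<theta>\<^sub>i\<close> at the vertex. At a nonzero boundary point (\<open>penalty_curvature_absorbed\<close>)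
  the part along the normal direction is absorbed by \<open>\<gamma>\<^sub>i\<close>. The remaining tangential part is
  \<open>\<rho> (\<parallel>tail g\<^sub>i\<parallel> - [g\<^sub>i]\<^sub>0) / (2 \<parallel>tail g\<^sub>i\<parallel>)\<close> times the squared length of the component of the tail
  orthogonal to \<open>tail g\<^sub>i\<close>. The sigma term contributes \<open>[\<omega>\<^sub>i]\<^sub>0 / [g\<^sub>i]\<^sub>0\<close> times the same quantity,
  and it dominates because \<open>2 [\<omega>\<^sub>i]\<^sub>0 \<ge> \<rho> (\<parallel>tail g\<^sub>i\<parallel> - [g\<^sub>i]\<^sub>0)\<close>, which holds for every estimate in the
  cone (\<open>multiplier_ge_penalty\<close>). The cross terms cost an arbitrarily small multiple of the identity.
\<close>


section \<open>Projection onto a closed convex cone\<close>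

lemma closest_point_cone_residual_nonneg:
  fixes C :: "'a::euclidean_space set"
  assumes "convex_cone C" "closed C" "y \<in> C"
  shows "0 \<le> (closest_point C z - z) \<bullet> y"
proof -
  have "closest_point C z \<in> C"
    using assms by (auto intro: closest_point_in_set)
  then have "closest_point C z + y \<in> C"
    using assms by (auto intro: convex_cone_add)
  moreover have "convex C"
    using assms by (simp add: convex_cone_def)
  ultimately have "(z - closest_point C z) \<bullet> (closest_point C z + y - closest_point C z) \<le> 0"
    using assms by (intro closest_point_dot)
  then show ?thesis
    by (simp add: inner_diff_left)
qed

lemma closest_point_cone_residual_orthogonal:
  fixes C :: "'a::euclidean_space set"
  assumes "convex_cone C" "closed C"
  shows "(closest_point C z - z) \<bullet> closest_point C z = 0"
proof (rule antisym)
  have "convex C" and "0 \<in> C"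
    using assms by (auto simp: convex_cone_def convex_cone_contains_0)
  then have "(z - closest_point C z) \<bullet> (0 - closest_point C z) \<le> 0"
    using assms by (intro closest_point_dot)
  then show "(closest_point C z - z) \<bullet> closest_point C z \<le> 0"
    by (simp add: inner_diff_left)
  have "closest_point C z \<in> C"
    using assms \<open>0 \<in> C\<close> by (auto intro: closest_point_in_set)
  then show "0 \<le> (closest_point C z - z) \<bullet> closest_point C z"
    using assms closest_point_cone_residual_nonneg by blast
qed

lemma closest_point_cone_scaleR:
  fixes C :: "'a::euclidean_space set"
  assumes "convex_cone C" "closed C" "0 < c"
  shows "closest_point C (c *\<^sub>R z) = c *\<^sub>R closest_point C z"
proof (rule closest_point_unique[symmetric])
  have "C \<noteq> {}"
    using assms by (simp add: convex_cone_nonempty)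
  show "convex C" "closed C"
    using assms by (auto simp: convex_cone_def)
  show "c *\<^sub>R closest_point C z \<in> C"
    using assms \<open>C \<noteq> {}\<close> by (auto intro: convex_cone_scaleR closest_point_in_set)
  show "\<forall>y\<in>C. dist (c *\<^sub>R z) (c *\<^sub>R closest_point C z) \<le> dist (c *\<^sub>R z) y"
  proof
    fix y assume "y \<in> C"
    define y' where "y' = (1/c) *\<^sub>R y"
    have "y' \<in> C"
      using assms \<open>y \<in> C\<close> unfolding y'_def by (intro convex_cone_scaleR) auto
    then have "dist z (closest_point C z) \<le> dist z y'"
      using assms by (intro closest_point_le) auto
    moreover have "y = c *\<^sub>R y'"
      using assms by (simp add: y'_def)
    ultimately show "dist (c *\<^sub>R z) (c *\<^sub>R closest_point C z) \<le> dist (c *\<^sub>R z) y"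
      using assms by (simp add: dist_norm flip: scaleR_diff_right)
  qed
qed

text \<open>
  By orthogonality of the residual, \<open>\<parallel>z - P z\<parallel>\<^sup>2 = \<parallel>z\<parallel>\<^sup>2 - \<parallel>P z\<parallel>\<^sup>2\<close>; comparing the distances from
  \<open>z\<close> to \<open>P z\<close> and to the competitor \<open>P y\<close> turns minimality into a subgradient inequality.
\<close>

lemma norm_closest_point_cone_increment:
  fixes C :: "'a::euclidean_space set"
  assumes "convex_cone C" "closed C"
  shows "(norm (closest_point C y))\<^sup>2 - (norm (closest_point C z))\<^sup>2
           \<le> 2 * (closest_point C y \<bullet> (y - z))"
proof -
  define p q where "p = closest_point C z" and "q = closest_point C y"
  have C: "C \<noteq> {}"
    using assms by (simp add: convex_cone_nonempty)
  have "q \<in> C"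
    unfolding q_def using assms C by (auto intro: closest_point_in_set)
  then have "dist z p \<le> dist z q"
    unfolding p_def using assms by (intro closest_point_le)
  then have "(norm (z - p))\<^sup>2 \<le> (norm (z - q))\<^sup>2"
    by (simp add: dist_norm)
  moreover have "(p - z) \<bullet> p = 0" "(q - y) \<bullet> q = 0"
    unfolding p_def q_def using assms by (auto intro: closest_point_cone_residual_orthogonal)
  ultimately show ?thesis
    unfolding p_def[symmetric] q_def[symmetric]
    by (simp add: power2_norm_eq_inner inner_diff_left inner_diff_right inner_commute)
qed

text \<open>
  The increments of the squared norm of the projection lie between the linear terms taken at either
  end point, and these differ by a quadratic quantity since the projection is nonexpansive. So the
  function is differentiable although the projection itself need not be.
\<close>

lemma has_derivative_norm_closest_point_cone:
  fixes C :: "'a::euclidean_space set"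
  assumes "convex_cone C" "closed C"
  shows "((\<lambda>y. (norm (closest_point C y))\<^sup>2) has_derivative (\<lambda>d. 2 * (closest_point C z \<bullet> d))) (at z)"
  unfolding has_derivative_at_within
proof (intro conjI)
  show "bounded_linear (\<lambda>d. 2 * (closest_point C z \<bullet> d))"
    by (intro bounded_linear_intros)
  let ?P = "closest_point C"
  let ?e = "\<lambda>y. ((norm (?P y))\<^sup>2 - (norm (?P z))\<^sup>2 - 2 * (?P z \<bullet> (y - z)))"
  have bound: "\<bar>?e y\<bar> \<le> 2 * (norm (y - z))\<^sup>2" for y
  proof -
    have "norm (?P y - ?P z) \<le> norm (y - z)"
      using closest_point_lipschitz[of C y z] assms(2) convex_cone_nonempty[OF assms(1)]
        assms(1)[unfolded convex_cone_def] by (simp add: dist_norm)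
    then have "norm (?P y - ?P z) * norm (y - z) \<le> (norm (y - z))\<^sup>2"
      unfolding power2_eq_square by (intro mult_right_mono) auto
    moreover have "(?P y - ?P z) \<bullet> (y - z) \<le> norm (?P y - ?P z) * norm (y - z)"
      by (rule norm_cauchy_schwarz)
    moreover have "?e y \<le> 2 * ((?P y - ?P z) \<bullet> (y - z))"
      using norm_closest_point_cone_increment[OF assms, of y z] by (simp add: inner_diff_left)
    ultimately have "?e y \<le> 2 * (norm (y - z))\<^sup>2"
      by linarith
    moreover have "0 \<le> ?e y"
      using norm_closest_point_cone_increment[OF assms, of z y] by (simp add: inner_diff_right)
    ultimately show ?thesis
      by simp
  qed
  show "((\<lambda>y. ?e y /\<^sub>R norm (y - z)) \<longlongrightarrow> 0) (at z)"
  proof (rule Lim_null_comparison)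
    show "\<forall>\<^sub>F y in at z. norm (?e y /\<^sub>R norm (y - z)) \<le> 2 * norm (y - z)"
      unfolding eventually_at_filter
    proof (intro always_eventually allI impI)
      fix y assume "y \<noteq> z"
      then show "norm (?e y /\<^sub>R norm (y - z)) \<le> 2 * norm (y - z)"
        using bound[of y] by (simp add: field_simps power2_eq_square)
    qed
    have "((\<lambda>y. 2 * norm (y - z)) \<longlongrightarrow> 2 * norm (z - z)) (at z)"
      by (intro tendsto_intros)
    then show "((\<lambda>y. 2 * norm (y - z)) \<longlongrightarrow> 0) (at z)"
      by simp
  qed
qed


section \<open>Geometry of the second-order cone\<close>

lemma sum_option_UNIV: "(\<Sum>a\<in>UNIV. F a) = F None + (\<Sum>j\<in>UNIV. F (Some j))"
  for F :: "'q::finite option \<Rightarrow> 'a::comm_monoid_add"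
  by (simp add: UNIV_option_conv sum.reindex)

lemma inner_block: "u \<bullet> w = hd0 u * hd0 w + tail u \<bullet> tail w"
  by (simp add: inner_vec_def sum_option_UNIV hd0_def tail_def)

lemma norm_block: "(norm u)\<^sup>2 = (hd0 u)\<^sup>2 + (norm (tail u))\<^sup>2"
  by (simp add: power2_norm_eq_inner inner_block) (simp add: power2_eq_square)

lemma hd0_simps [simp]:
  "hd0 0 = 0" "hd0 (u + w) = hd0 u + hd0 w" "hd0 (u - w) = hd0 u - hd0 w" "hd0 (- u) = - hd0 u"
  "hd0 (c *\<^sub>R u) = c * hd0 u" "hd0 (block a b) = a"
  by (simp_all add: hd0_def block_def)

lemma tail_simps [simp]:
  "tail 0 = 0" "tail (u + w) = tail u + tail w" "tail (u - w) = tail u - tail w"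
  "tail (- u) = - tail u" "tail (c *\<^sub>R u) = c *\<^sub>R tail u" "tail (block a b) = b"
  by (simp_all add: tail_def block_def vec_eq_iff)

lemma block_eqI: "hd0 u = hd0 w \<Longrightarrow> tail u = tail w \<Longrightarrow> u = w"
  by (simp add: vec_eq_iff hd0_def tail_def split_option_all)

lemma tendsto_hd0 [tendsto_intros]: "(u \<longlongrightarrow> a) F \<Longrightarrow> ((\<lambda>k. hd0 (u k)) \<longlongrightarrow> hd0 a) F"
  unfolding hd0_def by (intro tendsto_intros)

lemma tendsto_tail [tendsto_intros]: "(u \<longlongrightarrow> a) F \<Longrightarrow> ((\<lambda>k. tail (u k)) \<longlongrightarrow> tail a) F"
  unfolding tail_def by (intro tendsto_intros)

lemma continuous_on_hd0: "continuous_on S hd0"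
  unfolding hd0_def[abs_def] by (intro continuous_intros)

lemma continuous_on_tail: "continuous_on S tail"
  unfolding tail_def[abs_def] by (intro continuous_intros)

lemma zero_in_block_space [simp]: "0 \<in> block_space T"
  by (simp add: block_space_def)

lemma block_space_add: "u \<in> block_space T \<Longrightarrow> w \<in> block_space T \<Longrightarrow> u + w \<in> block_space T"
  by (simp add: block_space_def)

lemma block_space_diff: "u \<in> block_space T \<Longrightarrow> w \<in> block_space T \<Longrightarrow> u - w \<in> block_space T"
  by (simp add: block_space_def)

lemma block_space_scaleR: "u \<in> block_space T \<Longrightarrow> c *\<^sub>R u \<in> block_space T"
  by (simp add: block_space_def)

lemma closed_block_space: "closed (block_space T)"
proof -
  have "block_space T = (\<Inter>j\<in>-T. {w. tail w $ j = 0})"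
    by (auto simp: block_space_def)
  also have "closed \<dots>"
    by (intro closed_INT ballI closed_Collect_eq continuous_intros continuous_on_tail)
  finally show ?thesis .
qed

lemma closed_soc: "closed (soc T)"
proof -
  have "soc T = block_space T \<inter> {w. norm (tail w) \<le> hd0 w}"
    by (auto simp: soc_def)
  also have "closed \<dots>"
    by (intro closed_Int closed_block_space closed_Collect_le continuous_intros
        continuous_on_tail continuous_on_hd0)
  finally show ?thesis .
qed

lemma convex_cone_soc: "convex_cone (soc T)"
  unfolding convex_cone_iff
proof (intro conjI ballI allI impI)
  show "0 \<in> soc T"
    by (simp add: soc_def)
next
  fix u w assume "u \<in> soc T" "w \<in> soc T"
  then show "u + w \<in> soc T"
    using norm_triangle_ineq[of "tail u" "tail w"] by (auto simp: soc_def block_space_add)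
next
  fix u and c :: real assume "u \<in> soc T" "0 \<le> c"
  then show "c *\<^sub>R u \<in> soc T"
    by (auto simp: soc_def block_space_scaleR mult_left_mono)
qed

lemma soc_subset_block_space: "w \<in> soc T \<Longrightarrow> w \<in> block_space T"
  by (simp add: soc_def)

lemma hd0_soc_nonneg: "w \<in> soc T \<Longrightarrow> 0 \<le> hd0 w"
  using norm_ge_zero[of "tail w"] by (simp add: soc_def del: norm_ge_zero)

lemma closest_point_soc_in: "closest_point (soc T) z \<in> soc T"
  using closest_point_in_set[OF closed_soc] convex_cone_nonempty[OF convex_cone_soc] by blast

lemma soc_partition:
  assumes "w \<in> soc T"
  shows "w = 0 \<or> w \<in> bdp_soc T \<or> w \<in> int_soc T"
  using assms by (auto simp: soc_def bdp_soc_def int_soc_def intro: block_eqI)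

lemma bd_soc_subset: "bd_soc T \<subseteq> soc T"
proof -
  have "closedin (top_of_set (block_space T)) (soc T)"
    using closed_soc by (intro closed_subset) (auto simp: soc_def)
  then show ?thesis
    unfolding bd_soc_def by (rule frontier_of_subset_closedin)
qed

text \<open>
  A single test vector decides membership: the reflection \<open>(\<parallel>tail w\<parallel>, - tail w)\<close>, or \<open>(1, 0)\<close> when
  the tail of \<open>w\<close> vanishes.
\<close>

lemma soc_self_dual:
  assumes "w \<in> block_space T" and "\<And>y. y \<in> soc T \<Longrightarrow> 0 \<le> w \<bullet> y"
  shows "w \<in> soc T"
proof (cases "tail w = 0")
  case True
  have "block 1 0 \<in> soc T"
    by (simp add: soc_def block_space_def)
  from assms(2)[OF this] show ?thesis
    using assms(1) True by (simp add: soc_def inner_block)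
next
  case False
  have "block (norm (tail w)) (- tail w) \<in> soc T"
    using assms(1) by (simp add: soc_def block_space_def)
  from assms(2)[OF this] have "norm (tail w) * norm (tail w) \<le> hd0 w * norm (tail w)"
    by (simp add: inner_block dot_square_norm power2_eq_square)
  then show ?thesis
    using False assms(1) by (simp add: soc_def)
qed

text \<open>
  Moreau decomposition: since the cone is its own dual inside the block, the projection residual
  lies in the cone again.
\<close>

lemma closest_point_soc_residual:
  assumes "z \<in> block_space T"
  shows "closest_point (soc T) z - z \<in> soc T"
proof (rule soc_self_dual)
  show "closest_point (soc T) z - z \<in> block_space T"
    using assms closest_point_soc_in by (auto intro: block_space_diff soc_subset_block_space)
  show "0 \<le> (closest_point (soc T) z - z) \<bullet> y" if "y \<in> soc T" for y
    using that closest_point_cone_residual_nonneg convex_cone_soc closed_soc by blast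
qed

lemma closest_point_soc_zero_iff:
  assumes "z \<in> block_space T"
  shows "closest_point (soc T) (- z) = 0 \<longleftrightarrow> z \<in> soc T"
proof
  have "- z \<in> block_space T"
    using block_space_scaleR[OF assms, of "-1"] by simp
  moreover assume "closest_point (soc T) (- z) = 0"
  ultimately show "z \<in> soc T"
    using closest_point_soc_residual[of "- z" T] by simp
next
  let ?p = "closest_point (soc T) (- z)"
  assume "z \<in> soc T"
  then have "0 \<le> (?p + z) \<bullet> z"
    using closest_point_cone_residual_nonneg[OF convex_cone_soc closed_soc, of z T "- z"] by simp
  have "(?p + z) \<bullet> ?p = 0"
    using closest_point_cone_residual_orthogonal[OF convex_cone_soc closed_soc, of T "- z"] by simp
  moreover have "0 \<le> z \<bullet> ?p"
  proof -
    have "- (norm (tail z) * norm (tail ?p)) \<le> tail z \<bullet> tail ?p"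
      using norm_cauchy_schwarz[of "- tail z" "tail ?p"] by simp
    moreover have "norm (tail z) * norm (tail ?p) \<le> hd0 z * hd0 ?p"
      using \<open>z \<in> soc T\<close> closest_point_soc_in[of T "- z"] hd0_soc_nonneg
      by (intro mult_mono) (auto simp: soc_def)
    ultimately show ?thesis
      by (simp add: inner_block)
  qed
  ultimately have "?p \<bullet> ?p \<le> 0"
    by (simp add: inner_add_left)
  then show "?p = 0"
    by (metis inner_eq_zero_iff inner_ge_zero order_antisym)
qed

text \<open>
  Complementary vectors of the cone: the inner product splits into a product of leading entries and
  an inner product of tails, so orthogonality forces equality in the Cauchy-Schwarz inequality.
\<close>

lemma soc_complementarity:
  assumes "w \<in> soc T" "s \<in> soc T" "w \<bullet> s = 0" "s \<noteq> 0" "w \<noteq> 0"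
  shows "w \<in> bdp_soc T" and "s \<in> bdp_soc T"
    and "tail w /\<^sub>R norm (tail w) = - (tail s /\<^sub>R norm (tail s))"
proof -
  have pos: "0 < hd0 u" if "u \<in> soc T" "u \<noteq> 0" for u
    using soc_partition[OF that(1)] that norm_ge_zero[of "tail u"]
    by (auto simp: bdp_soc_def int_soc_def simp del: norm_ge_zero)
  note w0 = pos[OF assms(1,5)] and s0 = pos[OF assms(2,4)]
  have w: "norm (tail w) \<le> hd0 w" and s: "norm (tail s) \<le> hd0 s"
    using assms by (auto simp: soc_def)
  have "hd0 w * hd0 s = tail w \<bullet> (- tail s)"
    using assms(3) by (simp add: inner_block)
  also have cs: "\<dots> \<le> norm (tail w) * norm (tail s)"
    using norm_cauchy_schwarz[of "tail w" "- tail s"] by simp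
  finally have le: "hd0 w * hd0 s \<le> norm (tail w) * norm (tail s)" .
  also have "\<dots> \<le> hd0 w * norm (tail s)"
    using w by (simp add: mult_right_mono)
  finally have "hd0 s = norm (tail s)"
    using w0 s by simp
  moreover from le have "hd0 w * hd0 s \<le> norm (tail w) * hd0 s"
    using s by (meson mult_left_mono norm_ge_zero order_trans)
  then have "hd0 w = norm (tail w)"
    using s0 w by simp
  ultimately have eq: "hd0 w = norm (tail w)" "hd0 s = norm (tail s)"
    by auto
  then show "w \<in> bdp_soc T" "s \<in> bdp_soc T"
    using assms w0 s0 by (auto simp: bdp_soc_def soc_def)
  have "tail w \<bullet> (- tail s) = norm (tail w) * norm (- tail s)"
    using \<open>hd0 w * hd0 s = tail w \<bullet> (- tail s)\<close> eq by simp
  then have "norm (tail w) *\<^sub>R (- tail s) = norm (tail s) *\<^sub>R tail w"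
    by (subst (asm) norm_cauchy_schwarz_eq) simp
  then have "tail w /\<^sub>R norm (tail w) = (1 / (norm (tail w) * norm (tail s))) *\<^sub>R (norm (tail w) *\<^sub>R (- tail s))"
    using w0 s0 eq by (simp add: inverse_eq_divide)
  also have "\<dots> = - (tail s /\<^sub>R norm (tail s))"
    using w0 s0 eq by (simp add: divide_simps)
  finally show "tail w /\<^sub>R norm (tail w) = - (tail s /\<^sub>R norm (tail s))" .
qed

text \<open>
  The projection satisfies both \<open>w\<^sub>0 - z\<^sub>0 \<ge> \<parallel>tail w - tail z\<parallel>\<close> and \<open>w\<^sub>0 \<ge> \<parallel>tail w\<parallel>\<close>; adding the two
  bounds its leading entry without the explicit spectral formula.
\<close>

lemma hd0_closest_point_soc_ge:
  assumes "z \<in> block_space T"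
  shows "hd0 z + norm (tail z) \<le> 2 * hd0 (closest_point (soc T) z)"
proof -
  let ?w = "closest_point (soc T) z"
  have "norm (tail ?w - tail z) \<le> hd0 ?w - hd0 z"
    using closest_point_soc_residual[OF assms] by (simp add: soc_def)
  moreover have "norm (tail ?w) \<le> hd0 ?w"
    using closest_point_soc_in[of T z] by (simp add: soc_def)
  moreover have "norm (tail z) \<le> norm (tail ?w) + norm (tail ?w - tail z)"
    by (metis norm_triangle_sub norm_minus_commute)
  ultimately show ?thesis
    by linarith
qed


section \<open>Quadratic forms\<close>

lemma quadratic_form_sum:
  "d \<bullet> ((\<Sum>i\<in>A. M i) *v d) = (\<Sum>i\<in>A. d \<bullet> (M i *v d))"
  for d :: "real^'n"
  by (induction A rule: infinite_finite_induct)
    (auto simp: matrix_vector_mult_add_rdistrib inner_add_right)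

lemma quadratic_form_scaleR: "d \<bullet> ((c *\<^sub>R M) *v d) = c * (d \<bullet> (M *v d))"
  for d :: "real^'n"
  by (simp flip: scaleR_matrix_vector_assoc)

lemma quadratic_form_add: "d \<bullet> ((M + N) *v d) = d \<bullet> (M *v d) + d \<bullet> (N *v d)"
  for d :: "real^'n"
  by (simp add: matrix_vector_mult_add_rdistrib inner_add_right)

lemma inner_transpose: "d \<bullet> (transpose D *v w) = (D *v d) \<bullet> w"
  for d :: "real^'n" and D :: "real^'n^'m"
  by (metis dot_lmul_matrix inner_commute transpose_matrix_vector)

lemma quadratic_form_congruence:
  "d \<bullet> ((transpose D ** V ** D) *v d) = (D *v d) \<bullet> (V *v (D *v d))"
  "d \<bullet> ((transpose D ** D) *v d) = (norm (D *v d))\<^sup>2"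
  for d :: "real^'n" and D :: "real^'n^'m"
  by (simp_all only: inner_transpose power2_norm_eq_inner matrix_vector_mul_assoc[symmetric])

lemma outer_mult: "outer v *v d = (v \<bullet> d) *\<^sub>R v"
  by (simp add: vec_eq_iff outer_def matrix_vector_mult_def inner_vec_def sum_distrib_left
      sum_distrib_right mult.assoc mult.left_commute mult.commute)

lemma quadratic_form_outer: "d \<bullet> (outer v *v d) = (v \<bullet> d)\<^sup>2"
  by (simp add: outer_mult power2_eq_square inner_commute)

lemmas quadratic_form = quadratic_form_sum quadratic_form_scaleR quadratic_form_add
  quadratic_form_congruence quadratic_form_outer

lemma quadratic_form_le_onorm:
  fixes V :: "real^'m^'m"
  shows "u \<bullet> (V *v u) \<le> onorm ((*v) V) * (norm u)\<^sup>2"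
proof -
  have "u \<bullet> (V *v u) \<le> norm u * norm (V *v u)"
    by (rule norm_cauchy_schwarz)
  also have "norm (V *v u) \<le> onorm ((*v) V) * norm u"
    by (intro onorm matrix_vector_mul_bounded_linear)
  finally show ?thesis
    by (simp add: power2_eq_square mult.left_commute mult_left_mono)
qed

lemma Gam_mult: "Gam *v u = block (hd0 u) (- tail u)"
proof -
  have "(\<Sum>j\<in>UNIV. (if i \<noteq> j then 0 else - 1) * u $ Some j) = - u $ Some i" for i
  proof -
    have "(\<Sum>j\<in>UNIV. (if i \<noteq> j then 0 else - 1) * u $ Some j)
        = (\<Sum>j\<in>UNIV. if i = j then - u $ Some j else 0)"
      by (intro sum.cong) auto
    then show ?thesis
      by simp
  qed
  then show ?thesis
    by (simp add: vec_eq_iff split_option_all Gam_def block_def hd0_def tail_def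
        matrix_vector_mult_def sum_option_UNIV)
qed

lemma Mmat_mult:
  "Mmat \<xi> w *v u = (1/2) *\<^sub>R block (hd0 u + w \<bullet> tail u)
     (hd0 u *\<^sub>R w + (1 + \<xi>) *\<^sub>R tail u - (\<xi> * (w \<bullet> tail u)) *\<^sub>R w)"
proof (rule block_eqI)
  show "hd0 (Mmat \<xi> w *v u) = hd0 ((1/2) *\<^sub>R block (hd0 u + w \<bullet> tail u)
     (hd0 u *\<^sub>R w + (1 + \<xi>) *\<^sub>R tail u - (\<xi> * (w \<bullet> tail u)) *\<^sub>R w))"
    by (simp add: hd0_def block_def Mmat_def matrix_vector_mult_def sum_option_UNIV tail_def
        inner_vec_def sum_distrib_left add_divide_distrib sum_divide_distrib)
  have "(\<Sum>b\<in>UNIV. 1/2 * ((1 + \<xi>) * (if a = b then 1 else 0) - \<xi> * (w $ a * w $ b)) * tail u $ b)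
      = 1/2 * ((1 + \<xi>) * tail u $ a - \<xi> * (w \<bullet> tail u) * w $ a)" for a
  proof -
    have "(\<Sum>b\<in>UNIV. 1/2 * ((1 + \<xi>) * (if a = b then 1 else 0) - \<xi> * (w $ a * w $ b)) * tail u $ b)
      = (\<Sum>b\<in>UNIV. (if a = b then 1/2 * (1 + \<xi>) * tail u $ b else 0)
           - (1/2 * \<xi> * w $ a) * (w $ b * tail u $ b))"
      by (intro sum.cong) (auto simp: algebra_simps)
    also have "\<dots> = 1/2 * (1 + \<xi>) * tail u $ a - (1/2 * \<xi> * w $ a) * (w \<bullet> tail u)"
      unfolding sum_subtractf inner_vec_def sum_distrib_left[symmetric] by simp
    finally show ?thesis
      by (simp add: algebra_simps)
  qed
  note * = this
  show "tail (Mmat \<xi> w *v u) = tail ((1/2) *\<^sub>R block (hd0 u + w \<bullet> tail u)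
     (hd0 u *\<^sub>R w + (1 + \<xi>) *\<^sub>R tail u - (\<xi> * (w \<bullet> tail u)) *\<^sub>R w))"
    unfolding vec_eq_iff
  proof
    fix a
    have "tail (Mmat \<xi> w *v u) $ a = 1/2 * (w $ a * hd0 u) +
      (\<Sum>b\<in>UNIV. 1/2 * ((1 + \<xi>) * (if a = b then 1 else 0) - \<xi> * (w $ a * w $ b)) * tail u $ b)"
      by (simp add: hd0_def Mmat_def matrix_vector_mult_def sum_option_UNIV tail_def)
    then show "tail (Mmat \<xi> w *v u) $ a = tail ((1/2) *\<^sub>R block (hd0 u + w \<bullet> tail u)
     (hd0 u *\<^sub>R w + (1 + \<xi>) *\<^sub>R tail u - (\<xi> * (w \<bullet> tail u)) *\<^sub>R w)) $ a"
      unfolding * by (simp add: algebra_simps)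
  qed
qed

lemma quadratic_form_Gam: "u \<bullet> (Gam *v u) = (hd0 u)\<^sup>2 - (norm (tail u))\<^sup>2"
  by (simp add: Gam_mult inner_block power2_eq_square dot_square_norm)

lemma quadratic_form_Mmat:
  "u \<bullet> (Mmat \<xi> w *v u) =
     1/2 * ((hd0 u + w \<bullet> tail u)\<^sup>2 + (1 + \<xi>) * ((norm (tail u))\<^sup>2 - (w \<bullet> tail u)\<^sup>2))"
  by (simp add: Mmat_mult inner_block inner_add_right inner_diff_right dot_square_norm
      inner_commute[of _ w] power2_eq_square algebra_simps)

text \<open>
  This is where the curvature of the penalty is absorbed near a nonzero boundary point \<open>y\<close> of the
  cone. With \<open>w = - tail y / \<parallel>tail y\<parallel>\<close> and \<open>a = u\<^sub>0 + w \<bullet> tail u\<close> the form of \<open>Mmat\<close> is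
  \<open>(a\<^sup>2 + (1 + \<xi>) P) / 2\<close>, where \<open>P \<ge> 0\<close> is the squared length of the part of \<open>tail u\<close> orthogonal
  to \<open>w\<close>, while \<open>- Gam\<close> gives \<open>P + a\<^sup>2 - 2 u\<^sub>0 a\<close> and the rank one term gives \<open>\<parallel>tail y\<parallel>\<^sup>2 a\<^sup>2\<close>. The
  hypothesis on the multiplier \<open>m\<close> says that the \<open>P\<close>-part of the penalty is dominated by the sigma
  term; all that remains is a multiple of \<open>a\<^sup>2\<close> and a cross term \<open>u\<^sub>0 a\<close>, which Young's inequality
  splits into a small multiple of \<open>u\<^sub>0\<^sup>2\<close> and a large multiple of \<open>a\<^sup>2\<close>.
\<close>

lemma penalty_curvature_absorbed:
  fixes y u :: "real^('q::finite option)"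
  assumes "0 < hd0 y" "tail y \<noteq> 0" "0 \<le> \<rho>" "0 \<le> m" "0 < \<eta>"
    and m: "\<rho> * (norm (tail y) - hd0 y) \<le> 2 * m"
    and V: "V = 0 \<or> hd0 y \<le> norm (tail y) \<and>
      V = Mmat (- (hd0 y / norm (tail y))) (- (tail y /\<^sub>R norm (tail y)))"
  shows "\<rho> * (u \<bullet> (V *v u)) \<le> - (m / hd0 y) * (u \<bullet> (Gam *v u))
    + (\<rho>/2 + (m / hd0 y)\<^sup>2 / \<eta>) / (norm (tail y))\<^sup>2
        * ((Gam *v block (norm (tail y)) (tail y)) \<bullet> u)\<^sup>2
    + \<eta> * (norm u)\<^sup>2"
proof -
  define n where "n = norm (tail y)"
  define \<kappa> where "\<kappa> = m / hd0 y"
  define w where "w = - (tail y /\<^sub>R n)"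
  define a where "a = hd0 u + w \<bullet> tail u"
  define P where "P = (norm (tail u))\<^sup>2 - (w \<bullet> tail u)\<^sup>2"
  have n: "0 < n"
    using assms by (simp add: n_def)
  have "0 \<le> \<kappa>"
    using assms by (simp add: \<kappa>_def)
  have "norm w = 1"
    using n by (simp add: w_def n_def)
  have "(w \<bullet> tail u)\<^sup>2 \<le> (norm w * norm (tail u))\<^sup>2"
    using Cauchy_Schwarz_ineq2[of w "tail u"] by (rule abs_le_square_iff[THEN iffD1, OF order_trans]) simp
  then have P: "0 \<le> P"
    using \<open>norm w = 1\<close> by (simp add: P_def)
  have Gam: "u \<bullet> (Gam *v u) = 2 * hd0 u * a - a\<^sup>2 - P"
    by (simp add: quadratic_form_Gam a_def P_def power2_eq_square algebra_simps)
  have "(Gam *v block n (tail y)) \<bullet> u = n * a"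
    using n by (simp add: Gam_mult inner_block a_def w_def algebra_simps)
  then have rank_one: "((Gam *v block n (tail y)) \<bullet> u)\<^sup>2 / n\<^sup>2 = a\<^sup>2"
    using n by (simp add: power_mult_distrib)
  have "u \<bullet> (V *v u) = 0 \<or> hd0 y \<le> n \<and> u \<bullet> (V *v u) = 1/2 * (a\<^sup>2 + (1 - hd0 y / n) * P)"
    using V by (auto simp: quadratic_form_Mmat a_def P_def w_def n_def)
  then have "\<rho> * (u \<bullet> (V *v u)) \<le> \<rho>/2 * a\<^sup>2 + \<kappa> * P"
  proof
    assume "u \<bullet> (V *v u) = 0"
    then show ?thesis
      using assms P \<open>0 \<le> \<kappa>\<close> by simp
  next
    assume *: "hd0 y \<le> n \<and> u \<bullet> (V *v u) = 1/2 * (a\<^sup>2 + (1 - hd0 y / n) * P)"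
    have "\<rho>/2 * (1 - hd0 y / n) = (\<rho> * (n - hd0 y)) / (2 * n)"
      using n by (simp add: field_simps)
    also have "\<dots> \<le> (2 * m) / (2 * n)"
      using m n unfolding n_def[symmetric] by (intro divide_right_mono) auto
    also have "\<dots> \<le> \<kappa>"
      using * assms n by (simp add: \<kappa>_def frac_le)
    finally have "\<rho>/2 * (1 - hd0 y / n) * P \<le> \<kappa> * P"
      using P by (rule mult_right_mono)
    moreover have "\<rho> * (1/2 * (a\<^sup>2 + c * P)) = \<rho>/2 * a\<^sup>2 + \<rho>/2 * c * P" for c
      by (simp add: field_simps)
    ultimately show ?thesis
      unfolding *[THEN conjunct2] by (metis add_left_mono)
  qed
  moreover have "2 * \<kappa> * (hd0 u * a) \<le> \<eta> * (hd0 u)\<^sup>2 + \<kappa>\<^sup>2 / \<eta> * a\<^sup>2"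
  proof -
    have "0 \<le> (\<eta> * hd0 u - \<kappa> * a)\<^sup>2 / \<eta>"
      using assms by simp
    also have "\<dots> = \<eta> * (hd0 u)\<^sup>2 + \<kappa>\<^sup>2 / \<eta> * a\<^sup>2 - 2 * \<kappa> * (hd0 u * a)"
      using assms by (simp add: power2_eq_square field_simps)
    finally show ?thesis
      by simp
  qed
  moreover have "\<eta> * (hd0 u)\<^sup>2 \<le> \<eta> * (norm u)\<^sup>2"
    using assms by (simp add: norm_block)
  moreover have "0 \<le> \<kappa> * a\<^sup>2"
    using \<open>0 \<le> \<kappa>\<close> by simp
  ultimately have "\<rho> * (u \<bullet> (V *v u)) \<le>
      - \<kappa> * (2 * hd0 u * a - a\<^sup>2 - P) + (\<rho>/2 + \<kappa>\<^sup>2 / \<eta>) * a\<^sup>2 + \<eta> * (norm u)\<^sup>2"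
    by (simp add: algebra_simps)
  then show ?thesis
    unfolding \<kappa>_def[symmetric] n_def[symmetric] Gam rank_one[symmetric] by simp
qed


section \<open>The augmented Lagrangian\<close>

lemma grad_eqI:
  assumes "(F has_derivative D) (at x)" "(G has_derivative D) (at x)"
  shows "grad F x = grad G x"
  using frechet_derivative_at[OF assms(1)] frechet_derivative_at[OF assms(2)]
  by (simp add: grad_def)

context socp
begin

lemma f_differentiable: "f differentiable (at x)"
  using f_C2 by (simp add: twice_cont_diff_def)

lemma h_differentiable: "h differentiable (at x)"
proof -
  have "(\<lambda>y. h y \<bullet> b) differentiable (at x)" if b: "b \<in> Basis" for b
  proof -
    obtain i where "b = axis i 1"
      using b by (auto simp: Basis_vec_def)
    then show ?thesis
      using h_C2[of i] by (simp add: inner_axis twice_cont_diff_def)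
  qed
  then show ?thesis
    using differentiable_componentwise_within[of h x UNIV] by blast
qed

lemma g_differentiable: "g differentiable (at x)"
proof -
  have "(\<lambda>y. g y \<bullet> b) differentiable (at x)" if b: "b \<in> Basis" for b
  proof -
    obtain i a where "b = axis i (axis a 1)"
      using b by (auto simp: Basis_vec_def)
    then show ?thesis
      using g_C2[of i a] by (simp add: inner_axis twice_cont_diff_def)
  qed
  then show ?thesis
    using differentiable_componentwise_within[of g x UNIV] by blast
qed

lemma isCont_problem: "isCont f x" "isCont h x" "isCont g x"
  using f_differentiable h_differentiable g_differentiable
  by (simp_all add: differentiable_imp_continuous_within)

lemma closed_cones: "closed cones"
proof -
  have "cones = (\<Inter>i. {w. w $ i \<in> soc (J i)})"
    by (auto simp: cones_def)
  also have "closed \<dots>"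
  proof (intro closed_INT ballI)
    show "closed {w. w $ i \<in> soc (J i)}" for i
      using closed_vimage[OF closed_soc, of "\<lambda>w. w $ i" "J i"]
      by (simp add: vimage_def continuous_on_component)
  qed
  finally show ?thesis .
qed

lemma convex_cones: "convex cones"
proof (rule convexI)
  fix u w and a b :: real
  assume "u \<in> cones" "w \<in> cones" "0 \<le> a" "0 \<le> b" "a + b = 1"
  then show "a *\<^sub>R u + b *\<^sub>R w \<in> cones"
    by (auto simp: cones_def intro!: convex_cone_add convex_cone_scaleR convex_cone_soc)
qed

lemma closest_point_cones:
  "closest_point cones w = (\<chi> i. closest_point (soc (J i)) (w $ i))"
proof (rule closest_point_unique[symmetric])
  show "(\<chi> i. closest_point (soc (J i)) (w $ i)) \<in> cones"
    by (simp add: cones_def closest_point_soc_in)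
  show "\<forall>z\<in>cones. dist w (\<chi> i. closest_point (soc (J i)) (w $ i)) \<le> dist w z"
    by (subst (1 2) dist_vec_def, intro ballI L2_set_mono)
      (auto simp: cones_def intro: closest_point_le closed_soc)
qed (rule convex_cones closed_cones)+

text \<open>
  By the derivative of the squared norm of the projection, the gradient of the augmented Lagrangian
  is that of the ordinary Lagrangian at the updated multipliers.
\<close>

lemma grad_aug_lagr:
  assumes "0 < \<rho>"
    and \<omega>: "\<And>i. \<omega> $ i = closest_point (soc (J i)) (\<omega>h $ i - \<rho> *\<^sub>R g x $ i)"
  shows "grad (\<lambda>y. aug_lagr \<rho> y \<mu>h \<omega>h) x = grad_lagr x (- (\<mu>h - \<rho> *\<^sub>R h x)) \<omega>"
proof -
  obtain f' h' g' where f': "(f has_derivative f') (at x)" and h': "(h has_derivative h') (at x)"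
    and g': "(g has_derivative g') (at x)"
    using f_differentiable h_differentiable g_differentiable unfolding differentiable_def by metis
  let ?D = "\<lambda>d. f' d - h' d \<bullet> (\<mu>h - \<rho> *\<^sub>R h x) - g' d \<bullet> \<omega>"
  have "((\<lambda>y. lagr y (- (\<mu>h - \<rho> *\<^sub>R h x)) \<omega>) has_derivative
      (\<lambda>d. f' d + h' d \<bullet> (- (\<mu>h - \<rho> *\<^sub>R h x)) - g' d \<bullet> \<omega>)) (at x)"
    unfolding lagr_def by (intro derivative_intros f' h' g' has_derivative_inner_left)
  then have "((\<lambda>y. lagr y (- (\<mu>h - \<rho> *\<^sub>R h x)) \<omega>) has_derivative ?D) (at x)"
    by (simp only: inner_minus_right add_uminus_conv_diff)
  moreover have "((\<lambda>y. aug_lagr \<rho> y \<mu>h \<omega>h) has_derivative ?D) (at x)"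
  proof -
    have g_i: "((\<lambda>y. \<omega>h $ i - \<rho> *\<^sub>R g y $ i) has_derivative (\<lambda>d. - (\<rho> *\<^sub>R g' d $ i))) (at x)" for i
      by (auto intro!: derivative_eq_intros bounded_linear.has_derivative[OF bounded_linear_vec_nth g'])
    have P_i: "((\<lambda>y. (norm (closest_point (soc (J i)) (\<omega>h $ i - \<rho> *\<^sub>R g y $ i)))\<^sup>2 - (norm (\<omega>h $ i))\<^sup>2)
        has_derivative (\<lambda>d. 2 * (\<omega> $ i \<bullet> (- (\<rho> *\<^sub>R g' d $ i))) - 0)) (at x)" for i
      unfolding \<omega>
      by (intro has_derivative_diff has_derivative_const
        has_derivative_compose[OF g_i has_derivative_norm_closest_point_cone[OF convex_cone_soc closed_soc]])
    have H: "((\<lambda>y. (norm (\<mu>h - \<rho> *\<^sub>R h y))\<^sup>2) has_derivative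
        (\<lambda>d. 2 * ((\<mu>h - \<rho> *\<^sub>R h x) \<bullet> (- (\<rho> *\<^sub>R h' d))))) (at x)"
      unfolding power2_norm_eq_inner
      by (auto intro!: derivative_eq_intros h' simp: inner_commute)
    have "((\<lambda>y. aug_lagr \<rho> y \<mu>h \<omega>h) has_derivative
        (\<lambda>d. f' d + 1 / (2 * \<rho>) * (2 * ((\<mu>h - \<rho> *\<^sub>R h x) \<bullet> (- (\<rho> *\<^sub>R h' d)))
          + (\<Sum>i\<in>UNIV. 2 * (\<omega> $ i \<bullet> (- (\<rho> *\<^sub>R g' d $ i))) - 0)))) (at x)"
      unfolding aug_lagr_def
      by (intro has_derivative_add has_derivative_mult_right has_derivative_sum f' H P_i)
    moreover have "f' d + 1 / (2 * \<rho>) * (2 * ((\<mu>h - \<rho> *\<^sub>R h x) \<bullet> (- (\<rho> *\<^sub>R h' d)))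
          + (\<Sum>i\<in>UNIV. 2 * (\<omega> $ i \<bullet> (- (\<rho> *\<^sub>R g' d $ i))) - 0))
        = ?D d" for d
    proof -
      have "(\<Sum>i\<in>UNIV. 2 * (\<omega> $ i \<bullet> (- (\<rho> *\<^sub>R g' d $ i))) - 0) = - (2 * \<rho>) * (g' d \<bullet> \<omega>)"
        unfolding inner_vec_def[of "g' d" \<omega>] sum_distrib_left
        by (intro sum.cong) (auto simp: inner_commute)
      moreover have "2 * ((\<mu>h - \<rho> *\<^sub>R h x) \<bullet> (- (\<rho> *\<^sub>R h' d))) = - (2 * \<rho>) * (h' d \<bullet> (\<mu>h - \<rho> *\<^sub>R h x))"
        by (simp add: inner_commute)
      ultimately show ?thesis
        using assms by (simp add: field_simps)
    qed
    ultimately show ?thesis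
      by (simp only:)
  qed
  ultimately show ?thesis
    unfolding grad_lagr_def by (intro grad_eqI)
qed


section \<open>The second-order condition at one iterate\<close>

lemma Vmat_interior:
  assumes "g x $ i \<in> int_soc (J i)"
  shows "Vmat i x = 0"
proof -
  have "0 < hd0 (g x $ i)"
    using assms norm_ge_zero[of "tail (g x $ i)"] by (auto simp: int_soc_def simp del: norm_ge_zero)
  then have "- g x $ i \<notin> soc (J i)"
    using hd0_soc_nonneg by fastforce
  then show ?thesis
    using assms bd_soc_subset by (fastforce simp: Vmat_def int_soc_def soc_def)
qed

lemma Vmat_positive_head:
  assumes "0 < hd0 (g x $ i)"
  shows "Vmat i x = 0 \<or> hd0 (g x $ i) \<le> norm (tail (g x $ i)) \<and>
    Vmat i x = Mmat (- (hd0 (g x $ i) / norm (tail (g x $ i))))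
                    (- (tail (g x $ i) /\<^sub>R norm (tail (g x $ i))))"
proof (cases "g x $ i \<in> int_soc (J i)")
  case True
  then show ?thesis
    by (simp add: Vmat_interior)
next
  case False
  have "- g x $ i \<notin> soc (J i)"
    using assms hd0_soc_nonneg by fastforce
  then have "- g x $ i \<notin> bd_soc (J i) \<union> int_soc (J i)"
    using bd_soc_subset by (force simp: int_soc_def soc_def)
  moreover have "- g x $ i \<notin> uminus ` int_soc (J i)"
    using False by auto
  moreover have "hd0 (g x $ i) \<le> norm (tail (g x $ i))"
    using False g_block[of x i] by (auto simp: int_soc_def)
  ultimately show ?thesis
    by (simp add: Vmat_def)
qed

text \<open>
  Because the estimate lies in the cone, its leading entry compensates for the norm of its tail, so
  the bound that would hold with a zero estimate survives without an error term.
\<close>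

lemma multiplier_ge_penalty:
  assumes "0 < \<rho>" "\<omega>h \<in> soc (J i)" "y \<in> block_space (J i)"
  shows "\<rho> * (norm (tail y) - hd0 y) \<le> 2 * hd0 (closest_point (soc (J i)) (\<omega>h - \<rho> *\<^sub>R y))"
proof -
  have "\<omega>h - \<rho> *\<^sub>R y \<in> block_space (J i)"
    using assms by (auto intro: block_space_diff block_space_scaleR soc_subset_block_space)
  note hd0_closest_point_soc_ge[OF this]
  moreover have "norm (\<rho> *\<^sub>R tail y) - norm (tail \<omega>h) \<le> norm (tail \<omega>h - \<rho> *\<^sub>R tail y)"
    by (metis norm_minus_commute norm_triangle_ineq2)
  moreover have "norm (tail \<omega>h) \<le> hd0 \<omega>h"
    using assms by (simp add: soc_def)
  ultimately show ?thesis
    using assms by (simp add: algebra_simps)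
qed

text \<open>
  The Hessian of the Lagrangian is the same in both matrices, so only the penalty blocks have to be
  dominated: those at the vertex by a large \<open>\<theta>\<close>, those at a nonzero boundary point by the sigma term
  and a large \<open>\<gamma>\<close>, up to an arbitrarily small multiple of the identity; the interior ones vanish.
\<close>

lemma AKKT2_matrix_psd_exists:
  assumes feas: "feasible xs" and "0 < \<rho>" "0 < e"
    and psd: "psd (bar_hess_aug_lagr \<rho> x \<mu>h \<omega>h + \<epsilon> *\<^sub>R mat 1)"
    and \<omega>: "\<And>i. \<omega> $ i = closest_point (soc (J i)) (\<omega>h $ i - \<rho> *\<^sub>R g x $ i)"
    and \<omega>h: "\<omega>h \<in> cones"
    and int: "\<And>i. i \<in> II xs \<Longrightarrow> g x $ i \<in> int_soc (J i)"
    and bd: "\<And>i. i \<in> IB xs \<Longrightarrow> 0 < hd0 (g x $ i) \<and> tail (g x $ i) \<noteq> 0"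
  shows "\<exists>\<eta> \<theta> \<gamma>. \<forall>d. 0 \<le> d \<bullet>
    (AKKT2_matrix xs x (- (\<mu>h - \<rho> *\<^sub>R h x)) \<omega> \<eta> \<theta> \<gamma> (\<epsilon> + e) *v d)"
proof -
  let ?V = "\<lambda>i d. (Dg i x *v d) \<bullet> (Vmat i x *v (Dg i x *v d))"
  let ?S = "\<lambda>i d. - (hd0 (\<omega> $ i) / hd0 (g x $ i)) * ((Dg i x *v d) \<bullet> (Gam *v (Dg i x *v d)))"
  let ?R = "\<lambda>i d. ((transpose (Dg i x) *v (Gam *v gtilde i x)) \<bullet> d)\<^sup>2"
  let ?H = "\<lambda>d. d \<bullet> (hess_lagr x (- (\<mu>h - \<rho> *\<^sub>R h x)) \<omega> *v d)"
  let ?E = "\<lambda>d. \<Sum>i\<in>UNIV. (grad (\<lambda>y. h y $ i) x \<bullet> d)\<^sup>2"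
  define N where "N = real CARD('r)"
  have "0 < N"
    by (simp add: N_def)
  have "\<exists>c. \<forall>d. \<rho> * ?V i d \<le> ?S i d + c * ?R i d + e / N * (norm d)\<^sup>2" if i: "i \<in> IB xs" for i
  proof -
    define c where "c = onorm ((*v) (Dg i x))"
    \<comment> \<open>each of the \<open>N\<close> blocks may spend \<open>e / N\<close>; dividing by \<open>1 + c\<^sup>2\<close> undoes the passage from \<open>d\<close> to
        \<open>Dg\<^sub>i(x) d\<close>, and the summand 1 covers a vanishing derivative\<close>
    define t where "t = (e / N) / (1 + c\<^sup>2)"
    define k where "k = (\<rho>/2 + (hd0 (\<omega> $ i) / hd0 (g x $ i))\<^sup>2 / t) / (norm (tail (g x $ i)))\<^sup>2"
    have c1: "0 < 1 + c\<^sup>2"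
      by (simp add: add_pos_nonneg)
    then have t: "0 < t"
      using assms \<open>0 < N\<close> by (simp add: t_def)
    have "\<rho> * ?V i d \<le> ?S i d + k * ?R i d + e / N * (norm d)\<^sup>2" for d
    proof -
      have "?R i d = ((Gam *v block (norm (tail (g x $ i))) (tail (g x $ i))) \<bullet> (Dg i x *v d))\<^sup>2"
        by (metis inner_commute inner_transpose gtilde_def)
      then have "\<rho> * ?V i d \<le> ?S i d + k * ?R i d + t * (norm (Dg i x *v d))\<^sup>2"
        unfolding k_def using bd[OF i] \<open>0 < \<rho>\<close> t \<omega>[of i] \<omega>h g_block
        by (simp only:) (intro penalty_curvature_absorbed Vmat_positive_head multiplier_ge_penalty;
          force simp: cones_def intro: hd0_soc_nonneg closest_point_soc_in)
      also have "t * (norm (Dg i x *v d))\<^sup>2 \<le> t * (c * norm d)\<^sup>2"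
        using t onorm[OF matrix_vector_mul_bounded_linear, of "Dg i x" d]
        by (simp add: c_def power_mono)
      also have "\<dots> \<le> t * ((1 + c\<^sup>2) * (norm d)\<^sup>2)"
        using t by (simp add: power_mult_distrib mult_right_mono)
      also have "\<dots> = e / N * (norm d)\<^sup>2"
        using c1 by (simp add: t_def)
      finally show ?thesis
        by simp
    qed
    then show ?thesis
      by blast
  qed
  then obtain \<gamma> where \<gamma>: "\<And>i d. i \<in> IB xs \<Longrightarrow>
      \<rho> * ?V i d \<le> ?S i d + \<gamma> i * ?R i d + e / N * (norm d)\<^sup>2"
    by metis
  define \<theta> where "\<theta> i = \<rho> * onorm ((*v) (Vmat i x))" for i
  have \<theta>: "\<rho> * ?V i d \<le> \<theta> i * (norm (Dg i x *v d))\<^sup>2" for i d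
    using quadratic_form_le_onorm[of "Dg i x *v d" "Vmat i x"] \<open>0 < \<rho>\<close>
    by (simp add: \<theta>_def mult.assoc mult_left_mono)
  have part: "UNIV = I0 xs \<union> IB xs \<union> II xs"
    using feas soc_partition by (fastforce simp: feasible_def cones_def I0_def IB_def II_def)
  have disj: "I0 xs \<inter> IB xs = {}" "(I0 xs \<union> IB xs) \<inter> II xs = {}"
    by (auto simp: I0_def IB_def II_def bdp_soc_def int_soc_def)
  have "0 \<le> d \<bullet> (AKKT2_matrix xs x (- (\<mu>h - \<rho> *\<^sub>R h x)) \<omega> (\<chi> i. \<rho>) \<theta> \<gamma> (\<epsilon> + e) *v d)" for d
  proof -
    have "closest_point cones (\<omega>h - \<rho> *\<^sub>R g x) = \<omega>"
      by (simp add: closest_point_cones vec_eq_iff \<omega>)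
    then have "0 \<le> ?H d + \<rho> * ?E d + \<rho> * (\<Sum>i\<in>UNIV. ?V i d) + \<epsilon> * (norm d)\<^sup>2"
      using psd by (simp add: psd_def bar_hess_aug_lagr_def quadratic_form dot_square_norm)
    also have "\<rho> * (\<Sum>i\<in>UNIV. ?V i d)
        = (\<Sum>i\<in>I0 xs. \<rho> * ?V i d) + (\<Sum>i\<in>IB xs. \<rho> * ?V i d) + (\<Sum>i\<in>II xs. \<rho> * ?V i d)"
      unfolding part sum_distrib_left using disj by (simp add: sum.union_disjoint)
    also have "(\<Sum>i\<in>II xs. \<rho> * ?V i d) = 0"
      using int Vmat_interior by simp
    also have "(\<Sum>i\<in>I0 xs. \<rho> * ?V i d) \<le> (\<Sum>i\<in>I0 xs. \<theta> i * (norm (Dg i x *v d))\<^sup>2)"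
      by (intro sum_mono \<theta>)
    also have "(\<Sum>i\<in>IB xs. \<rho> * ?V i d)
        \<le> (\<Sum>i\<in>IB xs. ?S i d + \<gamma> i * ?R i d + e / N * (norm d)\<^sup>2)"
      by (intro sum_mono \<gamma>)
    also have "\<dots> = (\<Sum>i\<in>IB xs. ?S i d) + (\<Sum>i\<in>IB xs. \<gamma> i * ?R i d)
        + real (card (IB xs)) * (e / N) * (norm d)\<^sup>2"
      by (simp only: sum.distrib sum_constant mult.assoc)
    also have "real (card (IB xs)) * (e / N) * (norm d)\<^sup>2 \<le> e * (norm d)\<^sup>2"
    proof (rule mult_right_mono)
      have "real (card (IB xs)) \<le> N"
        by (simp add: N_def card_mono)
      then have "real (card (IB xs)) * (e / N) \<le> N * (e / N)"
        using \<open>0 < N\<close> \<open>0 < e\<close> by (intro mult_right_mono) auto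
      then show "real (card (IB xs)) * (e / N) \<le> e"
        using \<open>0 < N\<close> by simp
    qed simp
    finally have "0 \<le> ?H d + \<rho> * ?E d + ((\<Sum>i\<in>I0 xs. \<theta> i * (norm (Dg i x *v d))\<^sup>2)
        + ((\<Sum>i\<in>IB xs. ?S i d) + (\<Sum>i\<in>IB xs. \<gamma> i * ?R i d) + e * (norm d)\<^sup>2)) + \<epsilon> * (norm d)\<^sup>2"
      by simp
    then show ?thesis
      unfolding AKKT2_matrix_def sigma_term_def quadratic_form
      by (simp add: dot_square_norm sum_distrib_left algebra_simps)
  qed
  then show ?thesis
    by blast
qed

end


section \<open>Runs of the algorithm\<close>

lemma geometric_decay_tendsto_0:
  fixes r :: "nat \<Rightarrow> real"
  assumes "0 \<le> \<tau>" "\<tau> < 1" "\<And>k. 0 \<le> r k" "\<And>k. N \<le> k \<Longrightarrow> r (Suc k) \<le> \<tau> * r k"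
  shows "r \<longlonglongrightarrow> 0"
proof -
  have "r (n + N) \<le> \<tau> ^ n * r N" for n
  proof (induction n)
    case (Suc n)
    have "r (Suc n + N) \<le> \<tau> * r (n + N)"
      using assms(4)[of "n + N"] by simp
    also have "\<dots> \<le> \<tau> * (\<tau> ^ n * r N)"
      using Suc assms(1) by (rule mult_left_mono)
    finally show ?case
      by (simp add: mult.assoc)
  qed simp
  then have "\<forall>\<^sub>F n in sequentially. norm (r (n + N)) \<le> \<tau> ^ n * r N"
    using assms(3) by simp
  moreover have "(\<lambda>n. \<tau> ^ n * r N) \<longlonglongrightarrow> 0"
    using LIMSEQ_realpow_zero[OF assms(1,2)] by (rule tendsto_mult_left_zero)
  ultimately have "(\<lambda>n. r (n + N)) \<longlonglongrightarrow> 0"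
    by (rule Lim_null_comparison)
  then show ?thesis
    by (rule LIMSEQ_offset)
qed

lemma infnorm_tendsto_0_imp_tendsto_0:
  fixes u :: "nat \<Rightarrow> 'a::euclidean_space"
  assumes "(\<lambda>k. infnorm (u k)) \<longlonglongrightarrow> 0"
  shows "u \<longlonglongrightarrow> 0"
proof (rule Lim_null_comparison)
  show "\<forall>\<^sub>F k in sequentially. norm (u k) \<le> sqrt DIM('a) * infnorm (u k)"
    by (intro always_eventually allI norm_le_infnorm)
  show "(\<lambda>k. sqrt DIM('a) * infnorm (u k)) \<longlonglongrightarrow> 0"
    using assms by (rule tendsto_mult_right_zero)
qed

lemma bounded_scaled_tendsto_0:
  fixes u :: "nat \<Rightarrow> 'a::real_normed_vector"
  assumes "bounded (u ` {1..})" "filterlim \<rho> at_top sequentially" "strict_mono s" "\<And>k. 1 \<le> s k"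
  shows "(\<lambda>k. u (s k) /\<^sub>R \<rho> (s k)) \<longlonglongrightarrow> 0"
proof -
  obtain B where "\<forall>y\<in>u ` {1..}. norm y \<le> B"
    using assms(1) by (auto simp: bounded_iff)
  then have "norm (u (s k)) \<le> B" for k
    using assms(4) by simp
  then have "Bfun (\<lambda>k. u (s k)) sequentially"
    by (intro BfunI[of _ B] always_eventually) simp
  moreover have "filterlim (\<lambda>k. \<rho> (s k)) at_top sequentially"
    using assms(2) filterlim_subseq[OF assms(3)] by (rule filterlim_compose)
  then have "Zfun (\<lambda>k. inverse (\<rho> (s k))) sequentially"
    by (simp add: tendsto_Zfun_iff[where a = 0, simplified, symmetric] tendsto_inverse_0_at_top)
  ultimately have "Zfun (\<lambda>k. inverse (\<rho> (s k)) *\<^sub>R u (s k)) sequentially"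
    using bounded_bilinear.Zfun_prod_Bfun[OF bounded_bilinear_scaleR] by blast
  then show ?thesis
    by (simp add: tendsto_Zfun_iff)
qed

context socp
begin

text \<open>
  In this form only \<open>f\<close>, \<open>\<mu>\<close> and \<open>\<omega>\<close> are divided by the penalty, so the bracket tends to the squared
  infeasibility when the penalty tends to infinity and the multiplier estimates stay bounded.
\<close>

lemma aug_lagr_rescaled:
  assumes "0 < \<rho>"
  shows "aug_lagr \<rho> y \<mu> \<omega> = \<rho>/2 * (2 * (f y /\<^sub>R \<rho>) + (norm (\<mu> /\<^sub>R \<rho> - h y))\<^sup>2
    + (\<Sum>i\<in>UNIV. (norm (closest_point (soc (J i)) (\<omega> $ i /\<^sub>R \<rho> - g y $ i)))\<^sup>2
         - (norm (\<omega> $ i /\<^sub>R \<rho>))\<^sup>2))"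
proof -
  have "\<mu> - \<rho> *\<^sub>R h y = \<rho> *\<^sub>R (\<mu> /\<^sub>R \<rho> - h y)"
    using assms by (simp add: scaleR_diff_right)
  then have 1: "(norm (\<mu> - \<rho> *\<^sub>R h y))\<^sup>2 = \<rho>\<^sup>2 * (norm (\<mu> /\<^sub>R \<rho> - h y))\<^sup>2"
    using assms by (simp only: norm_scaleR power_mult_distrib power2_abs)
  have 2: "(norm (closest_point (soc (J i)) (\<omega> $ i - \<rho> *\<^sub>R g y $ i)))\<^sup>2 - (norm (\<omega> $ i))\<^sup>2
     = \<rho>\<^sup>2 * ((norm (closest_point (soc (J i)) (\<omega> $ i /\<^sub>R \<rho> - g y $ i)))\<^sup>2
         - (norm (\<omega> $ i /\<^sub>R \<rho>))\<^sup>2)" for i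
  proof -
    have "\<omega> $ i - \<rho> *\<^sub>R g y $ i = \<rho> *\<^sub>R (\<omega> $ i /\<^sub>R \<rho> - g y $ i)"
      using assms by (simp add: scaleR_diff_right)
    then have "closest_point (soc (J i)) (\<omega> $ i - \<rho> *\<^sub>R g y $ i)
        = \<rho> *\<^sub>R closest_point (soc (J i)) (\<omega> $ i /\<^sub>R \<rho> - g y $ i)"
      using closest_point_cone_scaleR[OF convex_cone_soc closed_soc assms] by simp
    then show ?thesis
      using assms by (simp add: power_mult_distrib right_diff_distrib power_inverse field_simps)
  qed
  show ?thesis
    unfolding aug_lagr_def 1 2 sum_distrib_left[symmetric]
    using assms by (simp add: power2_eq_square field_simps)
qed

lemma ALM_run_penalty:
  assumes run: "ALM_run \<gamma> \<tau> \<epsilon> \<rho> x \<mu>h \<omega>h v \<mu> \<omega>"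
  shows ALM_run_penalty_pos: "1 \<le> k \<Longrightarrow> 0 < \<rho> k"
    and ALM_run_penalty_mono: "1 \<le> j \<Longrightarrow> j \<le> k \<Longrightarrow> \<rho> j \<le> \<rho> k"
proof -
  have update: "\<rho> (Suc k) = \<rho> k \<or> \<rho> (Suc k) = \<gamma> * \<rho> k" if "1 \<le> k" for k
    using run that by (auto simp: ALM_run_def)
  have "1 < \<gamma>" "0 < \<rho> 1"
    using run by (auto simp: ALM_run_def)
  show pos: "0 < \<rho> k" if "1 \<le> k" for k
    using that
  proof (induction rule: dec_induct)
    case (step n)
    then show ?case
      using \<open>1 < \<gamma>\<close> update[of n] by auto
  qed (rule \<open>0 < \<rho> 1\<close>)
  show "\<rho> j \<le> \<rho> k" if "1 \<le> j" "j \<le> k" for j k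
    using that(2)
  proof (induction rule: dec_induct)
    case (step n)
    have "\<rho> n \<le> \<gamma> * \<rho> n"
      using pos[of n] \<open>1 < \<gamma>\<close> \<open>1 \<le> j\<close> step.hyps by simp
    then show ?case
      using step \<open>1 \<le> j\<close> update[of n] by auto
  qed simp
qed

lemma ALM_run_penalty_unbounded:
  assumes run: "ALM_run \<gamma> \<tau> \<epsilon> \<rho> x \<mu>h \<omega>h v \<mu> \<omega>"
    and fail: "\<And>N. 1 \<le> N \<Longrightarrow> \<exists>k\<ge>N. \<not> resid x v k \<le> ereal \<tau> * resid x v (k - 1)"
  shows "filterlim \<rho> at_top sequentially"
  unfolding filterlim_at_top
proof
  fix Z
  have "1 < \<gamma>" "0 < \<rho> 1"
    using run by (auto simp: ALM_run_def)
  have grow: "\<exists>k\<ge>1. \<gamma> ^ n * \<rho> 1 \<le> \<rho> k" for n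
  proof (induction n)
    case (Suc n)
    then obtain j where "1 \<le> j" "\<gamma> ^ n * \<rho> 1 \<le> \<rho> j"
      by blast
    moreover obtain k where "j \<le> k" "\<not> resid x v k \<le> ereal \<tau> * resid x v (k - 1)"
      using fail \<open>1 \<le> j\<close> by blast
    ultimately have "\<gamma> * (\<gamma> ^ n * \<rho> 1) \<le> \<gamma> * \<rho> k" and "\<rho> (Suc k) = \<gamma> * \<rho> k"
      using ALM_run_penalty_mono[OF run, of j k] run \<open>1 < \<gamma>\<close> by (auto simp: ALM_run_def)
    then show ?case
      by (intro exI[of _ "Suc k"]) (simp add: mult.assoc)
  qed auto
  obtain n where "Z / \<rho> 1 < \<gamma> ^ n"
    using real_arch_pow[OF \<open>1 < \<gamma>\<close>] by blast
  moreover obtain k where "1 \<le> k" "\<gamma> ^ n * \<rho> 1 \<le> \<rho> k"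
    using grow by blast
  ultimately have "Z \<le> \<rho> k"
    using \<open>0 < \<rho> 1\<close> by (simp add: divide_less_eq)
  then show "\<forall>\<^sub>F j in sequentially. Z \<le> \<rho> j"
    using ALM_run_penalty_mono[OF run \<open>1 \<le> k\<close>]
    by (auto simp: eventually_sequentially intro: order_trans)
qed

text \<open>
  The vector \<open>v + g(x)\<close> plays the role of a slack: it is \<open>1/\<rho>\<close> times the residual of the projection
  that defines the multiplier, so by the Moreau decomposition it is in the cone and complementary to
  the multiplier.
\<close>

lemma ALM_run_slack:
  assumes run: "ALM_run \<gamma> \<tau> \<epsilon> \<rho> x \<mu>h \<omega>h v \<mu> \<omega>" and k: "1 \<le> k"
  shows "v k $ i + g (x k) $ i \<in> soc (J i)"
    and "\<omega> k $ i \<bullet> (v k $ i + g (x k) $ i) = 0"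
proof -
  let ?z = "\<omega>h k $ i /\<^sub>R \<rho> k - g (x k) $ i"
  let ?P = "closest_point (soc (J i))"
  have \<rho>: "0 < \<rho> k"
    using ALM_run_penalty_pos[OF run k] .
  have slack: "v k $ i + g (x k) $ i = ?P ?z - ?z"
    using run k by (simp add: ALM_run_def)
  have "\<omega>h k \<in> cones"
    using run k by (simp add: ALM_run_def)
  then have "\<omega>h k $ i \<in> block_space (J i)"
    by (auto simp: cones_def intro: soc_subset_block_space)
  then have z: "?z \<in> block_space (J i)"
    using g_block by (intro block_space_diff block_space_scaleR)
  show "v k $ i + g (x k) $ i \<in> soc (J i)"
    unfolding slack using z by (rule closest_point_soc_residual)
  have "\<omega> k $ i = ?P (\<rho> k *\<^sub>R ?z)"
    using run k \<rho> by (simp add: ALM_run_def scaleR_diff_right)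
  then have "\<omega> k $ i = \<rho> k *\<^sub>R ?P ?z"
    using closest_point_cone_scaleR[OF convex_cone_soc closed_soc \<rho>] by simp
  then show "\<omega> k $ i \<bullet> (v k $ i + g (x k) $ i) = 0"
    unfolding slack
    using closest_point_cone_residual_orthogonal[OF convex_cone_soc closed_soc, of "J i" ?z]
    by (simp add: inner_commute)
qed

text \<open>
  If the residual test is eventually always passed, the residuals decay geometrically. Otherwise the
  penalty tends to infinity; then global minimality, compared with a feasible point and divided by
  the penalty, forces the infeasibility measure to vanish in the limit.
\<close>

lemma ALM_run_residuals_tendsto_0:
  assumes run: "ALM_run \<gamma> \<tau> \<epsilon> \<rho> x \<mu>h \<omega>h v \<mu> \<omega>" and z: "feasible z"
    and s: "strict_mono s" "\<And>k. 1 \<le> s k" and lim: "(\<lambda>k. x (s k)) \<longlonglongrightarrow> xs"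
  shows "(\<lambda>k. h (x (s k))) \<longlonglongrightarrow> 0" and "(\<lambda>k. v (s k)) \<longlonglongrightarrow> 0"
proof -
  have "(\<lambda>k. h (x (s k))) \<longlonglongrightarrow> 0 \<and> (\<lambda>k. v (s k)) \<longlonglongrightarrow> 0"
  proof (cases "\<exists>N\<ge>1. \<forall>k\<ge>N. resid x v k \<le> ereal \<tau> * resid x v (k - 1)")
    case True
    then obtain N where "1 \<le> N" and N: "\<And>k. N \<le> k \<Longrightarrow> resid x v k \<le> ereal \<tau> * resid x v (k - 1)"
      by blast
    define r where "r k = max (infnorm (h (x k))) (infnorm (v k))" for k
    have resid: "resid x v k = ereal (r k)" if "1 \<le> k" for k
      using that by (simp add: resid_def r_def)
    have "r \<longlonglongrightarrow> 0"
    proof (rule geometric_decay_tendsto_0)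
      show "0 \<le> \<tau>" "\<tau> < 1"
        using run by (auto simp: ALM_run_def)
      show "0 \<le> r k" for k
        by (simp add: r_def infnorm_pos_le le_max_iff_disj)
      show "r (Suc k) \<le> \<tau> * r k" if "N \<le> k" for k
        using N[of "Suc k"] that \<open>1 \<le> N\<close> by (simp add: resid)
    qed
    moreover have "\<forall>\<^sub>F k in sequentially. norm (infnorm (h (x k))) \<le> r k"
      "\<forall>\<^sub>F k in sequentially. norm (infnorm (v k)) \<le> r k"
      by (simp_all add: r_def infnorm_pos_le)
    ultimately have "(\<lambda>k. infnorm (h (x k))) \<longlonglongrightarrow> 0" "(\<lambda>k. infnorm (v k)) \<longlonglongrightarrow> 0"
      by (auto intro: Lim_null_comparison)
    then have "(\<lambda>k. h (x k)) \<longlonglongrightarrow> 0" "v \<longlonglongrightarrow> 0"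
      by (auto intro: infnorm_tendsto_0_imp_tendsto_0)
    from this[THEN LIMSEQ_subseq_LIMSEQ, OF s(1)] show ?thesis
      by (simp add: o_def)
  next
    case False
    then have \<rho>: "filterlim \<rho> at_top sequentially"
      using ALM_run_penalty_unbounded[OF run] by blast
    have "bounded (\<mu>h ` {1..})" "bounded (\<omega>h ` {1..})"
      using run by (auto simp: ALM_run_def)
    note mult = this[THEN bounded_scaled_tendsto_0[OF _ \<rho> s]]
    have \<mu>0: "(\<lambda>k. \<mu>h (s k) /\<^sub>R \<rho> (s k)) \<longlonglongrightarrow> 0"
      by (rule mult(1))
    have \<omega>0: "(\<lambda>k. \<omega>h (s k) $ i /\<^sub>R \<rho> (s k)) \<longlonglongrightarrow> 0" for i
      using tendsto_vec_nth[OF mult(2), of i] by simp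
    have \<rho>0: "(\<lambda>k. inverse (\<rho> (s k))) \<longlonglongrightarrow> 0"
      using filterlim_compose[OF \<rho> filterlim_subseq[OF s(1)]] by (rule tendsto_inverse_0_at_top)
    have F: "(\<lambda>k. f (x (s k))) \<longlonglongrightarrow> f xs" and H: "(\<lambda>k. h (x (s k))) \<longlonglongrightarrow> h xs"
      and G: "(\<lambda>k. g (x (s k))) \<longlonglongrightarrow> g xs"
      by (rule isCont_tendsto_compose[OF _ lim]; rule isCont_problem)+
    have P: "(\<lambda>k. closest_point (soc (J i)) (\<omega>h (s k) $ i /\<^sub>R \<rho> (s k) - y k $ i))
        \<longlonglongrightarrow> closest_point (soc (J i)) (- y' $ i)" if "y \<longlonglongrightarrow> y'" for y y' and i
    proof (rule isCont_tendsto_compose[OF continuous_at_closest_point])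
      show "convex (soc (J i))" "closed (soc (J i))" "soc (J i) \<noteq> {}"
        using convex_cone_soc[of "J i"] closed_soc by (auto simp: convex_cone_def)
      show "(\<lambda>k. \<omega>h (s k) $ i /\<^sub>R \<rho> (s k) - y k $ i) \<longlonglongrightarrow> - y' $ i"
        using tendsto_diff[OF \<omega>0 tendsto_vec_nth[OF that]] by simp
    qed
    \<comment> \<open>\<open>?\<Phi>\<close> is the rescaled augmented Lagrangian, \<open>?\<Psi>\<close> its limit, a measure of infeasibility\<close>
    let ?\<Phi> = "\<lambda>k y. 2 * (f y /\<^sub>R \<rho> (s k)) + (norm (\<mu>h (s k) /\<^sub>R \<rho> (s k) - h y))\<^sup>2
      + (\<Sum>i\<in>UNIV. (norm (closest_point (soc (J i)) (\<omega>h (s k) $ i /\<^sub>R \<rho> (s k) - g y $ i)))\<^sup>2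
         - (norm (\<omega>h (s k) $ i /\<^sub>R \<rho> (s k)))\<^sup>2)"
    let ?\<Psi> = "\<lambda>y. (norm (h y))\<^sup>2 + (\<Sum>i\<in>UNIV. (norm (closest_point (soc (J i)) (- g y $ i)))\<^sup>2)"
    have \<Phi>: "(\<lambda>k. ?\<Phi> k (y k)) \<longlonglongrightarrow> ?\<Psi> y'"
      if "(\<lambda>k. f (y k)) \<longlonglongrightarrow> f y'" "(\<lambda>k. h (y k)) \<longlonglongrightarrow> h y'" "(\<lambda>k. g (y k)) \<longlonglongrightarrow> g y'" for y y'
    proof -
      have "(\<lambda>k. ?\<Phi> k (y k)) \<longlonglongrightarrow> 2 * (0 *\<^sub>R f y') + (norm (0 - h y'))\<^sup>2
        + (\<Sum>i\<in>UNIV. (norm (closest_point (soc (J i)) (- g y' $ i)))\<^sup>2 - (norm (0 :: real^('q option)))\<^sup>2)"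
        by (intro tendsto_intros \<rho>0 \<mu>0 \<omega>0 P that)
      then show ?thesis
        by simp
    qed
    have "?\<Phi> k (x (s k)) \<le> ?\<Phi> k z" for k
    proof -
      have pos: "0 < \<rho> (s k)"
        using ALM_run_penalty_pos[OF run s(2)] .
      have "aug_lagr (\<rho> (s k)) (x (s k)) (\<mu>h (s k)) (\<omega>h (s k))
          \<le> aug_lagr (\<rho> (s k)) z (\<mu>h (s k)) (\<omega>h (s k))"
        using run s(2) by (auto simp: ALM_run_def)
      then show ?thesis
        unfolding aug_lagr_rescaled[OF pos] using pos by (simp only: mult_le_cancel_left_pos half_gt_zero)
    qed
    then have "?\<Psi> xs \<le> ?\<Psi> z"
      by (intro LIMSEQ_le[OF \<Phi>[OF F H G] \<Phi>[OF tendsto_const tendsto_const tendsto_const]]) auto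
    moreover have "closest_point (soc (J i)) (- g z $ i) = 0" for i
      using z closest_point_soc_zero_iff[OF g_block] by (simp add: feasible_def cones_def)
    then have "?\<Psi> z = 0"
      using z by (simp add: feasible_def)
    ultimately have "(norm (h xs))\<^sup>2 = 0"
      and "(\<Sum>i\<in>UNIV. (norm (closest_point (soc (J i)) (- g xs $ i)))\<^sup>2) = 0"
      by (smt (verit) sum_nonneg zero_le_power2)+
    then have "h xs = 0" and P0: "closest_point (soc (J i)) (- g xs $ i) = 0" for i
      by (auto simp: sum_nonneg_eq_0_iff)
    moreover have "(\<lambda>k. v (s k)) \<longlonglongrightarrow> 0"
    proof (rule vec_tendstoI)
      fix i
      have "v (s k) $ i = closest_point (soc (J i)) (\<omega>h (s k) $ i /\<^sub>R \<rho> (s k) - g (x (s k)) $ i)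
          - \<omega>h (s k) $ i /\<^sub>R \<rho> (s k)" for k
        using run s(2) by (simp add: ALM_run_def)
      then show "(\<lambda>k. v (s k) $ i) \<longlonglongrightarrow> 0 $ i"
        using tendsto_diff[OF P[OF G, of i] \<omega>0[of i]] P0[of i] by simp
    qed
    ultimately show ?thesis
      using H by simp
  qed
  then show "(\<lambda>k. h (x (s k))) \<longlonglongrightarrow> 0" "(\<lambda>k. v (s k)) \<longlonglongrightarrow> 0"
    by auto
qed

theorem ALM_accumulation_point_AKKT2:
  assumes gen: "ALM_generated x" and "feasible z" and acc: "accumulation_point x xs"
  shows "AKKT2 xs"
proof -
  obtain \<gamma> \<tau> \<epsilon> \<rho> \<mu>h \<omega>h v \<mu> \<omega> where run: "ALM_run \<gamma> \<tau> \<epsilon> \<rho> x \<mu>h \<omega>h v \<mu> \<omega>"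
    using gen by (auto simp: ALM_generated_def)
  obtain s0 where s0: "strict_mono s0" "(x \<circ> s0) \<longlonglongrightarrow> xs"
    using acc by (auto simp: accumulation_point_def)
  \<comment> \<open>the algorithm starts at index 1, so the initial point has to be skipped\<close>
  define s where "s k = s0 (Suc k)" for k
  have s: "strict_mono s" "\<And>k. 1 \<le> s k"
    using s0(1) seq_suble[OF s0(1)] by (auto simp: s_def strict_mono_def intro: order_trans[rotated])
  have lim: "(\<lambda>k. x (s k)) \<longlonglongrightarrow> xs"
    using LIMSEQ_Suc[OF s0(2)] by (simp add: s_def o_def)
  note res = ALM_run_residuals_tendsto_0[OF run \<open>feasible z\<close> s lim]
  have H: "(\<lambda>k. h (x (s k))) \<longlonglongrightarrow> h xs" and G: "(\<lambda>k. g (x (s k))) \<longlonglongrightarrow> g xs"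
    by (rule isCont_tendsto_compose[OF _ lim]; rule isCont_problem)+
  define y where "y i k = v (s k) $ i + g (x (s k)) $ i" for i k
  have y: "y i k \<in> soc (J i)" "\<omega> (s k) $ i \<bullet> y i k = 0" for i k
    unfolding y_def using ALM_run_slack[OF run s(2)] by auto
  have Gi: "(\<lambda>k. g (x (s k)) $ i) \<longlonglongrightarrow> g xs $ i" for i
    using tendsto_vec_nth[OF G] .
  have Y: "y i \<longlonglongrightarrow> g xs $ i" for i
    using tendsto_add[OF tendsto_vec_nth[OF res(2)] Gi, of i i] by (simp add: y_def[abs_def])
  have feas: "feasible xs"
    unfolding feasible_def
  proof
    show "g xs \<in> cones"
      using closed_sequentially[OF closed_soc y(1) Y] by (simp add: cones_def)
    show "h xs = 0"
      using LIMSEQ_unique[OF H res(1)] .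
  qed
  have \<omega>: "\<omega> (s k) $ i = closest_point (soc (J i)) (\<omega>h (s k) $ i - \<rho> (s k) *\<^sub>R g (x (s k)) $ i)" for k i
    using run s(2) by (simp add: ALM_run_def)
  then have \<omega>_soc: "\<omega> (s k) $ i \<in> soc (J i)" for k i
    by (simp add: closest_point_soc_in)

  \<comment> \<open>indices from which on the slacks and constraint values have the same position relative to the cones
      as their limits\<close>
  define good where "good k \<longleftrightarrow> (\<forall>i.
      (i \<in> II xs \<longrightarrow> y i k \<in> int_soc (J i) \<and> g (x (s k)) $ i \<in> int_soc (J i)) \<and>
      (i \<in> IB xs \<longrightarrow> y i k \<noteq> 0 \<and> 0 < hd0 (g (x (s k)) $ i) \<and> tail (g (x (s k)) $ i) \<noteq> 0))" for k
  have "\<forall>\<^sub>F k in sequentially. good k"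
    unfolding good_def
  proof (intro eventually_all_finite eventually_conj)
    fix i
    have int: "\<forall>\<^sub>F k in sequentially. u k \<in> int_soc (J i)"
      if "i \<in> II xs" "u \<longlonglongrightarrow> g xs $ i" "\<And>k. u k \<in> block_space (J i)" for u
    proof -
      have "(\<lambda>k. hd0 (u k) - norm (tail (u k))) \<longlonglongrightarrow> hd0 (g xs $ i) - norm (tail (g xs $ i))"
        by (intro tendsto_intros that)
      moreover have "0 < hd0 (g xs $ i) - norm (tail (g xs $ i))"
        using that by (simp add: II_def int_soc_def)
      ultimately have "\<forall>\<^sub>F k in sequentially. 0 < hd0 (u k) - norm (tail (u k))"
        by (rule order_tendstoD)
      then show ?thesis
        by eventually_elim (simp add: int_soc_def that)
    qed
    show "\<forall>\<^sub>F k in sequentially.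
        i \<in> II xs \<longrightarrow> y i k \<in> int_soc (J i) \<and> g (x (s k)) $ i \<in> int_soc (J i)"
      using int[OF _ Y soc_subset_block_space[OF y(1)]] int[OF _ Gi g_block]
      by (cases "i \<in> II xs") (auto intro: eventually_conj)
    show "\<forall>\<^sub>F k in sequentially.
        i \<in> IB xs \<longrightarrow> y i k \<noteq> 0 \<and> 0 < hd0 (g (x (s k)) $ i) \<and> tail (g (x (s k)) $ i) \<noteq> 0"
    proof (cases "i \<in> IB xs")
      case True
      then have "0 < hd0 (g xs $ i)" "tail (g xs $ i) \<noteq> 0"
        by (auto simp: IB_def bdp_soc_def)
      moreover from this(1) have "g xs $ i \<noteq> 0"
        by auto
      ultimately have "\<forall>\<^sub>F k in sequentially. 0 < hd0 (g (x (s k)) $ i)"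
        and "\<forall>\<^sub>F k in sequentially. tail (g (x (s k)) $ i) \<noteq> 0"
        and "\<forall>\<^sub>F k in sequentially. y i k \<noteq> 0"
        using order_tendstoD(1)[OF tendsto_hd0[OF Gi]] tendsto_imp_eventually_ne[OF tendsto_tail[OF Gi]]
          tendsto_imp_eventually_ne[OF Y[of i], of 0] by auto
      then show ?thesis
        by eventually_elim simp
    qed simp
  qed
  then obtain N where "{N..} \<subseteq> {k. good k}"
    by (auto simp: eventually_sequentially)
  then have "infinite {k. good k}"
    using infinite_super infinite_Ici by blast
  \<comment> \<open>the AKKT conditions ask for one alternative along the whole sequence, so the set of vanishing
      multiplier blocks is made constant by passing to a further subsequence\<close>
  moreover have "finite ((\<lambda>k. {i. \<omega> (s k) $ i = 0}) ` {k. good k})"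
    by (rule finite_subset[OF subset_UNIV]) simp
  ultimately obtain k0 where inf: "infinite {k \<in> {k. good k}. {i. \<omega> (s k) $ i = 0} = {i. \<omega> (s k0) $ i = 0}}"
    using pigeonhole_infinite by blast
  define S where "S = {k \<in> {k. good k}. {i. \<omega> (s k) $ i = 0} = {i. \<omega> (s k0) $ i = 0}}"
  have "infinite S"
    unfolding S_def by (rule inf)
  define r where "r = enumerate S"
  have r: "strict_mono r" and S: "\<And>n. r n \<in> S"
    unfolding r_def using \<open>infinite S\<close> by (auto intro: strict_mono_enumerate enumerate_in_set)
  have good: "good (r n)" and zero: "\<omega> (s (r n)) $ i = 0 \<longleftrightarrow> \<omega> (s k0) $ i = 0" for n i
    using S[of n] by (auto simp: S_def)
  define t where "t k = s (r k)" for k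
  have t: "strict_mono t" "\<And>k. 1 \<le> t k"
    using s r by (auto simp: t_def strict_mono_def)
  have \<epsilon>: "(\<lambda>k. \<epsilon> (t k)) \<longlonglongrightarrow> 0" "0 \<le> \<epsilon> (t k)" for k
    using run t LIMSEQ_subseq_LIMSEQ[OF _ t(1), of \<epsilon> 0] by (auto simp: ALM_run_def o_def)
  have \<mu>: "\<mu> (t k) = \<mu>h (t k) - \<rho> (t k) *\<^sub>R h (x (t k))" for k
    using run t(2) by (simp add: ALM_run_def)
  have pos: "0 < \<rho> (t k)" for k
    using ALM_run_penalty_pos[OF run t(2)] .

  have seqs: "AKKT_seqs xs (\<lambda>k. x (t k)) (\<lambda>k. - \<mu> (t k)) (\<lambda>k. \<omega> (t k))"
    unfolding AKKT_seqs_def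
  proof (intro conjI allI ballI)
    show "\<omega> (t k) \<in> cones" for k
      using \<omega>_soc by (simp add: cones_def t_def)
    show "(\<lambda>k. x (t k)) \<longlonglongrightarrow> xs"
      using LIMSEQ_subseq_LIMSEQ[OF lim r] by (simp add: o_def t_def)
    have "grad (\<lambda>y. aug_lagr (\<rho> (t k)) y (\<mu>h (t k)) (\<omega>h (t k))) (x (t k))
        = grad_lagr (x (t k)) (- \<mu> (t k)) (\<omega> (t k))" for k
      unfolding \<mu> by (intro grad_aug_lagr pos) (simp add: t_def \<omega>)
    moreover have "norm (grad (\<lambda>y. aug_lagr (\<rho> (t k)) y (\<mu>h (t k)) (\<omega>h (t k))) (x (t k))) \<le> \<epsilon> (t k)" for k
      using run t(2) by (simp add: ALM_run_def)
    ultimately have "norm (grad_lagr (x (t k)) (- \<mu> (t k)) (\<omega> (t k))) \<le> \<epsilon> (t k)" for k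
      by simp
    then show "(\<lambda>k. grad_lagr (x (t k)) (- \<mu> (t k)) (\<omega> (t k))) \<longlonglongrightarrow> 0"
      by (intro Lim_null_comparison[OF always_eventually \<epsilon>(1)]) simp
  next
    fix i assume i: "i \<in> II xs"
    have "\<omega> (t k) $ i = 0" for k
    proof (rule ccontr)
      have int: "y i (r k) \<in> int_soc (J i)"
        using good i by (auto simp: good_def)
      then have "y i (r k) \<noteq> 0"
        by (auto simp: int_soc_def)
      moreover assume "\<omega> (t k) $ i \<noteq> 0"
      ultimately have "y i (r k) \<in> bdp_soc (J i)"
        using soc_complementarity(2)[OF \<omega>_soc y] by (simp add: t_def)
      then show False
        using int by (simp add: bdp_soc_def int_soc_def)
    qed
    then show "(\<lambda>k. \<omega> (t k) $ i) \<longlonglongrightarrow> 0"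
      by simp
  next
    fix i assume i: "i \<in> IB xs"
    show "(\<lambda>k. \<omega> (t k) $ i) \<longlonglongrightarrow> 0 \<or> (\<forall>k. \<omega> (t k) $ i \<in> bdp_soc (J i)) \<and>
        (\<lambda>k. tail (\<omega> (t k) $ i) /\<^sub>R norm (tail (\<omega> (t k) $ i)))
          \<longlonglongrightarrow> - (tail (g xs $ i) /\<^sub>R norm (tail (g xs $ i)))"
    proof (cases "\<omega> (s k0) $ i = 0")
      case True
      then have "\<omega> (t k) $ i = 0" for k
        by (simp add: t_def zero)
      then show ?thesis
        by simp
    next
      case False
      have ne: "y i (r k) \<noteq> 0" "\<omega> (s (r k)) $ i \<noteq> 0" for k
        using good[of k] i zero False by (auto simp: good_def)
      note compl = soc_complementarity[OF \<omega>_soc y ne]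
      have "(\<lambda>k. - (tail (y i (r k)) /\<^sub>R norm (tail (y i (r k)))))
          \<longlonglongrightarrow> - (tail (g xs $ i) /\<^sub>R norm (tail (g xs $ i)))"
        using i LIMSEQ_subseq_LIMSEQ[OF Y r, of i]
        by (intro tendsto_intros) (auto simp: o_def IB_def bdp_soc_def)
      then show ?thesis
        using compl by (simp add: t_def)
    qed
  qed

  have "\<exists>\<eta> \<theta> \<gamma>'. \<forall>d. 0 \<le> d \<bullet> (AKKT2_matrix xs (x (t k)) (- \<mu> (t k)) (\<omega> (t k)) \<eta> \<theta> \<gamma>'
      (\<epsilon> (t k) + inverse (real (Suc k))) *v d)" for k
    unfolding \<mu>
  proof (rule AKKT2_matrix_psd_exists[OF feas pos])
    show "psd (bar_hess_aug_lagr (\<rho> (t k)) (x (t k)) (\<mu>h (t k)) (\<omega>h (t k)) + \<epsilon> (t k) *\<^sub>R mat 1)"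
      and "\<omega>h (t k) \<in> cones"
      using run t(2) by (auto simp: ALM_run_def)
    show "\<omega> (t k) $ i = closest_point (soc (J i)) (\<omega>h (t k) $ i - \<rho> (t k) *\<^sub>R g (x (t k)) $ i)" for i
      using \<omega> by (simp add: t_def)
    show "g (x (t k)) $ i \<in> int_soc (J i)" if "i \<in> II xs" for i
      using good[of k] that by (simp add: good_def t_def)
    show "0 < hd0 (g (x (t k)) $ i) \<and> tail (g (x (t k)) $ i) \<noteq> 0" if "i \<in> IB xs" for i
      using good[of k] that by (simp add: good_def t_def)
  qed simp
  then obtain \<eta> \<theta> \<gamma>' where mat: "\<And>k d. 0 \<le> d \<bullet> (AKKT2_matrix xs (x (t k)) (- \<mu> (t k)) (\<omega> (t k))
      (\<eta> k) (\<theta> k) (\<gamma>' k) (\<epsilon> (t k) + inverse (real (Suc k))) *v d)"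
    by metis
  have "(\<lambda>k. \<epsilon> (t k) + inverse (real (Suc k))) \<longlonglongrightarrow> 0"
    using tendsto_add[OF \<epsilon>(1) LIMSEQ_inverse_real_of_nat] by simp
  moreover have "0 \<le> \<epsilon> (t k) + inverse (real (Suc k))" for k
    using \<epsilon>(2)[of k] by simp
  ultimately show ?thesis
    unfolding AKKT2_def using feas seqs mat
    by (intro conjI exI[of _ "\<lambda>k. x (t k)"] exI[of _ "\<lambda>k. - \<mu> (t k)"] exI[of _ "\<lambda>k. \<omega> (t k)"]
        exI[of _ \<eta>] exI[of _ \<theta>] exI[of _ \<gamma>'] exI[of _ "\<lambda>k. \<epsilon> (t k) + inverse (real (Suc k))"]) auto
qed

end

theorem theorem5p1:
  fixes f :: "real^'n \<Rightarrow> real"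
    and g :: "real^'n \<Rightarrow> real^('q::finite option)^'r"
    and h :: "real^'n \<Rightarrow> real^'p"
    and J :: "'r \<Rightarrow> 'q set"
    and x :: "nat \<Rightarrow> real^'n"
    and xs :: "real^'n"
  assumes "socp f g h J"
    and "\<exists>z. socp.feasible g h J z"
    and "socp.ALM_generated f g h J x"
    and "accumulation_point x xs"
  shows "socp.AKKT2 f g h J xs"
  using assms socp.ALM_accumulation_point_AKKT2 by blast

end
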